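(* Let $\lambda<1$ and $0<\beta<1-\lambda$. Then $$\lim_{N\to\infty}\frac1N\mathbb E\log Z_N(\beta,\lambda;J)=-\frac12\log(1-\lambda),$$ i.e. the quenched pressure at zero external field coincides with the annealed one.
   Context: For $N\ge 1$, $\beta>0$, $\lambda\in\mathbb{R}$, let $J=(J_{ij})_{i,j=1}^N$ be $N^2$ i.i.d. standard Gaussian $\mathcal N(0,1)$ random variables (one for each ordered pair $(i,j)$, diagonal pairs included). $\mathbb E_z$ denotes integration with respect to the standard Gaussian measure $(2\pi)^{-N/2}e^{-\|z\|^2/2}dz$ on $\mathbb R^N$, and $\mathbb E$ denotes expectation with respect to the disorder. The (zero-field) partition function is $$Z_N(\beta,\lambda;J)=\mathbb E_z\exp\Big(\frac{\beta}{\sqrt{2N}}\sum_{i,j=1}^N J_{ij}z_iz_j-\frac{\beta^2}{4N}\Big(\sum_{i=1}^N z_i^2\Big)^2+\frac{\lambda}{2}\sum_{i=1}^N z_i^2\Big).$$ *)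

theory Defs
  imports "HOL-Probability.Probability"
begin

definition gauss1 :: "real measure" where
  "gauss1 = density lborel std_normal_density"

text \<open>Standard Gaussian measure on R^N, vectors z indexed by {..<N}
  (the paper's indices 1..N are shifted to 0..N-1).\<close>
definition gaussVec :: "nat \<Rightarrow> (nat \<Rightarrow> real) measure" where
  "gaussVec N = PiM {..<N} (\<lambda>_. gauss1)"

definition gaussDisorder :: "nat \<Rightarrow> (nat \<times> nat \<Rightarrow> real) measure" where
  "gaussDisorder N = PiM ({..<N} \<times> {..<N}) (\<lambda>_. gauss1)"

definition Hexp :: "nat \<Rightarrow> real \<Rightarrow> real \<Rightarrow> (nat \<times> nat \<Rightarrow> real) \<Rightarrow> (nat \<Rightarrow> real) \<Rightarrow> real" where
  "Hexp N \<beta> lam J z =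
     \<beta> / sqrt (2 * real N) * (\<Sum>i<N. \<Sum>j<N. J (i, j) * z i * z j)
     - \<beta>\<^sup>2 / (4 * real N) * (\<Sum>i<N. (z i)\<^sup>2)\<^sup>2
     + lam / 2 * (\<Sum>i<N. (z i)\<^sup>2)"

definition Z :: "nat \<Rightarrow> real \<Rightarrow> real \<Rightarrow> (nat \<times> nat \<Rightarrow> real) \<Rightarrow> real" where
  "Z N \<beta> lam J = (\<integral>z. exp (Hexp N \<beta> lam J z) \<partial>gaussVec N)"

definition quenchedPressure :: "nat \<Rightarrow> real \<Rightarrow> real \<Rightarrow> real" where
  "quenchedPressure N \<beta> lam = (\<integral>J. ln (Z N \<beta> lam J) \<partial>gaussDisorder N) / real N"

end

(* The upper bound is Jensen's inequality with E Z = (1 - lam)^(-N/2).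

   For the lower bound restrict z to the ball |z|^2 <= R = N (1 + r) / (1 - lam), which by a Chernoff
   bound carries a fixed fraction of the annealed mass; the plain second moment of Z is infinite.
   The rest is Guerra's quadratic coupling of replicas, discretised in the time t at which
   the disorder has strength sqrt t. Let a(t) = - E log Z_t for the normalised truncated
   model, and let c(z,w) be the covariance of the Hamiltonian. Adding an independent
   disorder of variance s raises a by at most 2 s E <c>_t + O(s^(3/2)), where < > is the two-replica
   Gibbs average. By Jensen's inequality in both directions,
     r E <c>_t <= E log <exp (r c)>_t <= log (double integral of exp ((t + r) c)) + 2 a(t),
   and under the truncation the double integral is bounded uniformly in N for t <= 1 as long as
   ((1 + r) beta / (1 - lam))^2 < 1. Gronwall's lemma then bounds a(1) uniformly in N. *)
theory Submission
  imports Defs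
begin

subsection \<open>Gaussian measures\<close>

text \<open>The tilt by lam concentrates |z|^2 near N / (1 - lam). With c(z,w) = beta^2 (z.w)^2 / (2
  N), the tilted integral of exp c over w converges only for |z|^2 < N (1 - lam) / beta^2. The
  hypothesis beta < 1 - lam says that the typical radius lies below the critical one, so the
  divergent region can be cut off at the price of a constant factor. A bounded truncated second
  moment alone would bound Z from below only with positive probability, which does not control E log
  Z. The quadratic coupling takes the place of a concentration estimate: a(t) itself reappears on
  the right, so the inequality closes. Finite time steps avoid derivatives in t and Gaussian
  integration by parts; a step needs only an independent Gaussian increment and a second-order lower
  bound for log under a Gibbs measure. The error constant depends on N, but at fixed N the total
  error vanishes with the step size. Since c is a square, the double integral increases with the
  coupling, and its value at 1 + r serves all times.\<close>

lemma sets_gauss1 [simp, measurable_cong]: "sets gauss1 = sets borel"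
  and space_gauss1 [simp]: "space gauss1 = UNIV"
  by (simp_all add: gauss1_def)

interpretation gauss1: prob_space gauss1
  unfolding gauss1_def by (rule prob_space_normal_density) simp

interpretation gauss_PiM: product_prob_space "\<lambda>_. gauss1" I for I :: "'i set"
  by unfold_locales

lemma nn_integral_gauss1:
  assumes [measurable]: "f \<in> borel_measurable borel"
  shows "(\<integral>\<^sup>+x. f x \<partial>gauss1) = (\<integral>\<^sup>+x. ennreal (std_normal_density x) * f x \<partial>lborel)"
  unfolding gauss1_def by (subst nn_integral_density) auto

text \<open>Completing the square: with \<open>p = 1 - 2*\<alpha>\<close> the integrand is a
  constant times the normal density of mean \<open>c/p\<close> and variance
  \<open>1/p\<close>.\<close>

lemma nn_integral_gauss1_exp_quadratic:
  assumes "\<alpha> < 1/2"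
  shows "(\<integral>\<^sup>+x. ennreal (exp (\<alpha> * x\<^sup>2 + c * x)) \<partial>gauss1)
    = ennreal (exp (c\<^sup>2 / (2 * (1 - 2*\<alpha>))) / sqrt (1 - 2*\<alpha>))"
proof -
  define p where "p = 1 - 2*\<alpha>"
  have p: "p > 0" "\<alpha> = (1 - p)/2" using assms by (auto simp: p_def)
  have "std_normal_density x * exp (\<alpha> * x\<^sup>2 + c * x)
      = (exp (c\<^sup>2 / (2 * p)) / sqrt p) * normal_density (c/p) (1 / sqrt p) x" for x
  proof -
    have "- x\<^sup>2 / 2 + (\<alpha> * x\<^sup>2 + c * x) = c\<^sup>2 / (2 * p) - (x - c/p)\<^sup>2 / (2 * (1 / sqrt p)\<^sup>2)"
      unfolding p(2) using p(1) by (simp add: power_divide field_simps power2_eq_square)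
    then have eq1: "exp (- x\<^sup>2 / 2) * exp (\<alpha> * x\<^sup>2 + c * x)
      = exp (c\<^sup>2 / (2 * p)) * exp (- (x - c/p)\<^sup>2 / (2 * (1 / sqrt p)\<^sup>2))"
      by (simp add: exp_add [symmetric])
    have eq2: "sqrt (2 * pi * (1 / sqrt p)\<^sup>2) = sqrt (2*pi) / sqrt p"
      using p by (simp add: power_divide real_sqrt_divide)
    have "std_normal_density x * exp (\<alpha> * x\<^sup>2 + c * x)
      = (exp (- x\<^sup>2 / 2) * exp (\<alpha> * x\<^sup>2 + c * x)) / sqrt (2 * pi)"
      by (simp add: std_normal_density_def)
    then show ?thesis
      unfolding eq1 normal_density_def eq2 using p(1) by simp
  qed
  then have "(\<integral>\<^sup>+x. ennreal (exp (\<alpha> * x\<^sup>2 + c * x)) \<partial>gauss1)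
     = (\<integral>\<^sup>+x. ennreal (exp (c\<^sup>2 / (2 * p)) / sqrt p) * ennreal (normal_density (c/p) (1 / sqrt p) x) \<partial>lborel)"
    using p(1) by (subst nn_integral_gauss1) (auto simp: ennreal_mult[symmetric] intro!: nn_integral_cong)
  also have "\<dots> = ennreal (exp (c\<^sup>2 / (2 * p)) / sqrt p) * 1"
    using p(1) prob_space.emeasure_space_1[OF prob_space_normal_density, of "1 / sqrt p" "c / p"]
    by (subst nn_integral_cmult) (auto simp: emeasure_density)
  finally show ?thesis by (simp add: p_def)
qed

lemma nn_integral_PiM_exp_quadratic:
  assumes "finite I" "\<alpha> < 1/2"
  shows "(\<integral>\<^sup>+z. ennreal (exp (\<alpha> * (\<Sum>i\<in>I. (z i)\<^sup>2) + (\<Sum>i\<in>I. c i * z i))) \<partial>PiM I (\<lambda>_. gauss1))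
    = ennreal (exp ((\<Sum>i\<in>I. (c i)\<^sup>2) / (2 * (1 - 2*\<alpha>))) / sqrt (1 - 2*\<alpha>) ^ card I)"
proof -
  have "(\<integral>\<^sup>+z. ennreal (exp (\<alpha> * (\<Sum>i\<in>I. (z i)\<^sup>2) + (\<Sum>i\<in>I. c i * z i))) \<partial>PiM I (\<lambda>_. gauss1))
     = (\<integral>\<^sup>+z. (\<Prod>i\<in>I. ennreal (exp (\<alpha> * (z i)\<^sup>2 + c i * z i))) \<partial>PiM I (\<lambda>_. gauss1))"
    using assms(1)
    by (simp add: prod_ennreal exp_sum[symmetric] sum.distrib sum_distrib_left)
  also have "\<dots> = (\<Prod>i\<in>I. (\<integral>\<^sup>+z. ennreal (exp (\<alpha> * z\<^sup>2 + c i * z)) \<partial>gauss1))"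
    using assms(1) by (subst gauss_PiM.product_nn_integral_prod) auto
  also have "\<dots> = (\<Prod>i\<in>I. ennreal (exp ((c i)\<^sup>2 / (2 * (1 - 2*\<alpha>))) / sqrt (1 - 2*\<alpha>)))"
    using assms(2) by (simp add: nn_integral_gauss1_exp_quadratic)
  also have "\<dots> = ennreal (exp ((\<Sum>i\<in>I. (c i)\<^sup>2) / (2 * (1 - 2*\<alpha>))) / sqrt (1 - 2*\<alpha>) ^ card I)"
    using assms by (simp add: prod_ennreal prod_dividef exp_sum sum_divide_distrib)
  finally show ?thesis .
qed

lemma nn_integral_PiM_exp_linear:
  assumes "finite I"
  shows "(\<integral>\<^sup>+J. ennreal (exp (\<Sum>i\<in>I. c i * J i)) \<partial>PiM I (\<lambda>_. gauss1)) = ennreal (exp ((\<Sum>i\<in>I. (c i)\<^sup>2) / 2))"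
  using nn_integral_PiM_exp_quadratic[OF assms, of 0 c] by simp

text \<open>For \<open>a > 0\<close>, rescaling each variable turns the double integral into a
  convolution of two centred normal densities, whose variances \<open>a\<^sup>2\<close> and
  \<open>b\<^sup>2\<close> add up to 1. With values in \<open>ennreal\<close>, Tonelli needs no
  integrability.\<close>

lemma nn_integral_gauss1_rotate:
  assumes [measurable]: "f \<in> borel_measurable borel" and ab: "a\<^sup>2 + b\<^sup>2 = 1" "a \<ge> 0" "b > 0"
  shows "(\<integral>\<^sup>+u. \<integral>\<^sup>+v. f (a * u + b * v) \<partial>gauss1 \<partial>gauss1) = (\<integral>\<^sup>+x. f x \<partial>gauss1)"
proof (cases "a = 0")
  \<comment> \<open>The convolution formula requires two positive deviations. This degenerate case
    is the first time step, which starts at \<open>t = 0\<close>.\<close>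
  case True
  then show ?thesis using ab by (simp add: power2_eq_1_iff gauss1.emeasure_space_1[simplified])
next
  case False
  then have a: "a > 0" using ab by simp
  have scale: "(\<integral>\<^sup>+u. g (c * u) \<partial>gauss1) = (\<integral>\<^sup>+x. ennreal (normal_density 0 c x) * g x \<partial>lborel)"
    if [measurable]: "g \<in> borel_measurable borel" and c: "c > 0" for g :: "real \<Rightarrow> ennreal" and c
  proof -
    have "(\<integral>\<^sup>+x. ennreal (normal_density 0 c x) * g x \<partial>lborel)
       = ennreal c * (\<integral>\<^sup>+x. ennreal (normal_density 0 c (c * x)) * g (c * x) \<partial>lborel)"
      using c by (subst nn_integral_real_affine[where c=c and t=0]) auto
    also have "\<dots> = (\<integral>\<^sup>+x. ennreal (c * normal_density 0 c (c * x)) * g (c * x) \<partial>lborel)"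
      using c by (subst nn_integral_cmult[symmetric]) (auto simp: ennreal_mult mult.assoc)
    also have "\<dots> = (\<integral>\<^sup>+x. ennreal (std_normal_density x) * g (c * x) \<partial>lborel)"
      using c by (intro nn_integral_cong)
        (simp add: normal_density_def power_mult_distrib real_sqrt_mult)
    finally show ?thesis by (simp add: nn_integral_gauss1)
  qed
  have "(\<integral>\<^sup>+u. \<integral>\<^sup>+v. f (a * u + b * v) \<partial>gauss1 \<partial>gauss1)
     = (\<integral>\<^sup>+u. (\<lambda>y. \<integral>\<^sup>+x. ennreal (normal_density 0 b x) * f (y + x) \<partial>lborel) (a * u) \<partial>gauss1)"
    using ab by (simp add: scale[of "\<lambda>x. f (_ + x)"])
  also have "\<dots> = (\<integral>\<^sup>+y. ennreal (normal_density 0 a y) * (\<integral>\<^sup>+x. ennreal (normal_density 0 b x) * f (y + x) \<partial>lborel) \<partial>lborel)"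
    using a by (subst scale) auto
  also have "\<dots> = (\<integral>\<^sup>+y. ennreal (normal_density 0 a y) * (\<integral>\<^sup>+x. ennreal (normal_density 0 b (x - y)) * f x \<partial>lborel) \<partial>lborel)"
  proof (rule nn_integral_cong, rule arg_cong2[where f="(*)", OF refl])
    fix y :: real
    show "(\<integral>\<^sup>+x. ennreal (normal_density 0 b x) * f (y + x) \<partial>lborel)
        = (\<integral>\<^sup>+x. ennreal (normal_density 0 b (x - y)) * f x \<partial>lborel)"
      by (subst nn_integral_real_affine[where c=1 and t="- y"]) auto
  qed
  also have "\<dots> = (\<integral>\<^sup>+y. \<integral>\<^sup>+x. ennreal (normal_density 0 b (x - y) * normal_density 0 a y) * f x \<partial>lborel \<partial>lborel)"
    by (subst nn_integral_cmult[symmetric]) (auto simp: ennreal_mult ac_simps)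
  also have "\<dots> = (\<integral>\<^sup>+x. \<integral>\<^sup>+y. ennreal (normal_density 0 b (x - y) * normal_density 0 a y) * f x \<partial>lborel \<partial>lborel)"
    by (subst lborel_pair.Fubini') auto
  also have "\<dots> = (\<integral>\<^sup>+x. (\<integral>\<^sup>+y. ennreal (normal_density 0 b (x - y) * normal_density 0 a y) \<partial>lborel) * f x \<partial>lborel)"
    by (subst nn_integral_multc) auto
  also have "\<dots> = (\<integral>\<^sup>+x. ennreal (std_normal_density x) * f x \<partial>lborel)"
    using conv_normal_density_zero_mean[OF ab(3) a] ab by (simp add: fun_eq_iff add.commute)
  finally show ?thesis by (simp add: nn_integral_gauss1)
qed

abbreviation gaussPi :: "'i set \<Rightarrow> ('i \<Rightarrow> real) measure" where
  "gaussPi I \<equiv> PiM I (\<lambda>_. gauss1)"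

text \<open>Induction on \<open>I\<close>: the one-dimensional rotation handles the new coordinate,
  the induction hypothesis the others.\<close>

lemma nn_integral_gaussPi_rotate:
  assumes "finite I" and ab: "a\<^sup>2 + b\<^sup>2 = 1" "a \<ge> 0" "b > 0"
  shows "f \<in> borel_measurable (gaussPi I) \<Longrightarrow>
    (\<integral>\<^sup>+J. \<integral>\<^sup>+G. f (\<lambda>i\<in>I. a * J i + b * G i) \<partial>gaussPi I \<partial>gaussPi I) = (\<integral>\<^sup>+J. f J \<partial>gaussPi I)"
  using assms(1)
proof (induction I arbitrary: f rule: finite_induct)
  case empty
  show ?case
    unfolding PiM_empty by (simp add: nn_integral_count_space_finite restrict_def)
next
  case (insert i I f)
  note [simp] = \<open>finite I\<close> \<open>i \<notin> I\<close>
  note [measurable] = insert.prems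
  have [measurable]: "(\<lambda>p. (\<lambda>j\<in>I. a * fst p j + b * snd p j)) \<in> gaussPi I \<Otimes>\<^sub>M gaussPi I \<rightarrow>\<^sub>M gaussPi I"
    by (rule measurable_restrict) measurable
  have upd: "(\<lambda>j\<in>insert i I. a * (J(i := u)) j + b * (G(i := v)) j) = (\<lambda>j\<in>I. a * J j + b * G j)(i := a * u + b * v)" for J G u v
    by (auto simp: fun_eq_iff)
  have "(\<integral>\<^sup>+J. f J \<partial>gaussPi (insert i I)) = (\<integral>\<^sup>+J. (\<integral>\<^sup>+y. f (J(i := y)) \<partial>gauss1) \<partial>gaussPi I)"
    by (rule gauss_PiM.product_nn_integral_insert) auto
  also have "\<dots> = (\<integral>\<^sup>+J. \<integral>\<^sup>+G. (\<integral>\<^sup>+y. f ((\<lambda>j\<in>I. a * J j + b * G j)(i := y)) \<partial>gauss1) \<partial>gaussPi I \<partial>gaussPi I)"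
    by (rule insert.IH[symmetric]) measurable
  also have "\<dots> = (\<integral>\<^sup>+J. \<integral>\<^sup>+G. (\<integral>\<^sup>+u. \<integral>\<^sup>+v. f ((\<lambda>j\<in>I. a * J j + b * G j)(i := a * u + b * v)) \<partial>gauss1 \<partial>gauss1) \<partial>gaussPi I \<partial>gaussPi I)"
  proof (rule nn_integral_cong, rule nn_integral_cong, rule nn_integral_gauss1_rotate[OF _ ab, symmetric])
    fix J G :: "'a \<Rightarrow> real"
    have "(\<lambda>j\<in>I. a * J j + b * G j) \<in> space (gaussPi I)" by (simp add: space_PiM)
    then have "(\<lambda>y. (\<lambda>j\<in>I. a * J j + b * G j)(i := y)) \<in> gauss1 \<rightarrow>\<^sub>M gaussPi (insert i I)"
      by (rule measurable_component_update) simp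
    from measurable_compose[OF this insert.prems]
    show "(\<lambda>y. f ((\<lambda>j\<in>I. a * J j + b * G j)(i := y))) \<in> borel_measurable borel"
      by (simp add: measurable_cong_sets[OF sets_gauss1 refl] del: restrict_upd fun_upd_apply)
  qed
  \<comment> \<open>Exchanging \<open>u\<close> and \<open>G\<close> lets \<open>u\<close> complete
    \<open>J\<close>, and \<open>v\<close> complete \<open>G\<close>, to vectors over
    \<open>insert i I\<close>.\<close>
  also have "\<dots> = (\<integral>\<^sup>+J. \<integral>\<^sup>+u. \<integral>\<^sup>+G. \<integral>\<^sup>+v. f ((\<lambda>j\<in>I. a * J j + b * G j)(i := a * u + b * v)) \<partial>gauss1 \<partial>gaussPi I \<partial>gauss1 \<partial>gaussPi I)"
    by (intro nn_integral_cong pair_sigma_finite.Fubini'[symmetric]) (auto simp: pair_sigma_finite_def gauss1.sigma_finite_measure_axioms gauss_PiM.P.sigma_finite_measure_axioms simp del: restrict_upd fun_upd_apply)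
  also have "\<dots> = (\<integral>\<^sup>+J. \<integral>\<^sup>+G. f (\<lambda>j\<in>insert i I. a * J j + b * G j) \<partial>gaussPi (insert i I) \<partial>gaussPi (insert i I))"
    by (subst gauss_PiM.product_nn_integral_insert; (subst gauss_PiM.product_nn_integral_insert)?) (auto simp: upd simp del: restrict_upd fun_upd_apply)
  finally show ?case ..
qed

text \<open>As an identity of laws, the rotation also applies to \<open>ln Zf\<close>, which takes
  both signs.\<close>

lemma distr_gaussPi_rotate:
  assumes "finite I" and ab: "a\<^sup>2 + b\<^sup>2 = 1" "a \<ge> 0" "b > 0"
  shows "distr (gaussPi I \<Otimes>\<^sub>M gaussPi I) (gaussPi I) (\<lambda>p. \<lambda>i\<in>I. a * fst p i + b * snd p i) = gaussPi I"
proof (rule measure_eqI)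
  fix A assume "A \<in> sets (distr (gaussPi I \<Otimes>\<^sub>M gaussPi I) (gaussPi I) (\<lambda>p. \<lambda>i\<in>I. a * fst p i + b * snd p i))"
  then have [measurable]: "A \<in> sets (gaussPi I)" by simp
  have m[measurable]: "(\<lambda>p. (\<lambda>j\<in>I. a * fst p j + b * snd p j)) \<in> gaussPi I \<Otimes>\<^sub>M gaussPi I \<rightarrow>\<^sub>M gaussPi I"
    by (rule measurable_restrict) measurable
  have "emeasure (distr (gaussPi I \<Otimes>\<^sub>M gaussPi I) (gaussPi I) (\<lambda>p. \<lambda>i\<in>I. a * fst p i + b * snd p i)) A
     = (\<integral>\<^sup>+J. indicator A J \<partial>(distr (gaussPi I \<Otimes>\<^sub>M gaussPi I) (gaussPi I) (\<lambda>p. \<lambda>i\<in>I. a * fst p i + b * snd p i)))"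
    by simp
  also have "\<dots> = (\<integral>\<^sup>+p. indicator A (\<lambda>i\<in>I. a * fst p i + b * snd p i) \<partial>(gaussPi I \<Otimes>\<^sub>M gaussPi I))"
    by (rule nn_integral_distr) measurable
  also have "\<dots> = (\<integral>\<^sup>+J. \<integral>\<^sup>+G. indicator A (\<lambda>i\<in>I. a * J i + b * G i) \<partial>gaussPi I \<partial>gaussPi I)"
    by (subst gauss_PiM.P.nn_integral_fst[symmetric]) auto
  also have "\<dots> = emeasure (gaussPi I) A"
    by (subst nn_integral_gaussPi_rotate[OF assms]) auto
  finally show "emeasure (distr (gaussPi I \<Otimes>\<^sub>M gaussPi I) (gaussPi I) (\<lambda>p. \<lambda>i\<in>I. a * fst p i + b * snd p i)) A = emeasure (gaussPi I) A" .
qed simp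

subsection \<open>Exchange of integrals and Jensen inequalities\<close>

text \<open>Meant for \<open>P\<close> the disorder and \<open>\<rho>\<close> the configurations.
  The disorder integral is explicit at each configuration, so doing it first yields both the
  integrability of a partition function and its mean.\<close>

lemma Fubini_nonneg:
  fixes f :: "'a \<times> 'b \<Rightarrow> real" and g :: "'b \<Rightarrow> real"
  assumes "sigma_finite_measure P" "sigma_finite_measure \<rho>"
    and [measurable]: "f \<in> borel_measurable (P \<Otimes>\<^sub>M \<rho>)" and f: "\<And>p. 0 \<le> f p"
    and g: "\<And>w. w \<in> space \<rho> \<Longrightarrow> (\<integral>\<^sup>+G. ennreal (f (G, w)) \<partial>P) = ennreal (g w)"
    and int: "integrable \<rho> g" and g0: "\<And>w. 0 \<le> g w"
  shows "integrable (P \<Otimes>\<^sub>M \<rho>) f"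
    and "integrable P (\<lambda>G. \<integral>w. f (G, w) \<partial>\<rho>)"
    and "(\<integral>G. \<integral>w. f (G, w) \<partial>\<rho> \<partial>P) = (\<integral>w. g w \<partial>\<rho>)"
proof -
  interpret P: sigma_finite_measure P by fact
  interpret R: sigma_finite_measure \<rho> by fact
  interpret pair_sigma_finite P \<rho> ..
  have nn: "(\<integral>\<^sup>+p. ennreal (f p) \<partial>(P \<Otimes>\<^sub>M \<rho>)) = ennreal (\<integral>w. g w \<partial>\<rho>)"
  proof -
    have "(\<integral>\<^sup>+p. ennreal (f p) \<partial>(P \<Otimes>\<^sub>M \<rho>)) = (\<integral>\<^sup>+w. \<integral>\<^sup>+G. ennreal (f (G, w)) \<partial>P \<partial>\<rho>)"
      by (subst nn_integral_snd[symmetric]) auto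
    also have "\<dots> = (\<integral>\<^sup>+w. ennreal (g w) \<partial>\<rho>)" by (intro nn_integral_cong g)
    also have "\<dots> = ennreal (\<integral>w. g w \<partial>\<rho>)" using int g0 by (intro nn_integral_eq_integral) auto
    finally show ?thesis .
  qed
  show i: "integrable (P \<Otimes>\<^sub>M \<rho>) f"
    using nn f by (intro integrableI_nonneg) auto
  show "integrable P (\<lambda>G. \<integral>w. f (G, w) \<partial>\<rho>)" by (rule integrable_fst'[OF i])
  have "(\<integral>G. \<integral>w. f (G, w) \<partial>\<rho> \<partial>P) = (\<integral>p. f p \<partial>(P \<Otimes>\<^sub>M \<rho>))"
    by (rule integral_fst'[OF i])
  also have "\<dots> = (\<integral>w. g w \<partial>\<rho>)"
    using nn f g0 by (intro integral_eq_nn_integral[THEN trans]) auto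
  finally show "(\<integral>G. \<integral>w. f (G, w) \<partial>\<rho> \<partial>P) = (\<integral>w. g w \<partial>\<rho>)" .
qed

text \<open>Jensen through the tangent of \<open>ln\<close> at the mean. Positivity is asked almost
  everywhere only, because \<open>Z\<close>, a Bochner integral, defaults to 0 for a disorder whose
  integrand is not integrable.\<close>

lemma (in prob_space) expectation_ln_le:
  fixes X :: "'a \<Rightarrow> real"
  assumes "integrable M X" "integrable M (\<lambda>\<omega>. ln (X \<omega>))" "expectation X > 0" "AE \<omega> in M. X \<omega> > 0"
  shows "expectation (\<lambda>\<omega>. ln (X \<omega>)) \<le> ln (expectation X)"
proof -
  define c where "c = expectation X"
  have c: "c > 0" using assms by (simp add: c_def)
  have "ln y \<le> y / c - 1 + ln c" if "y > 0" for y
    using ln_le_minus_one[of "y / c"] c that by (simp add: ln_div)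
  then have "expectation (\<lambda>\<omega>. ln (X \<omega>)) \<le> expectation (\<lambda>\<omega>. X \<omega> / c - 1 + ln c)"
    using assms by (intro integral_mono_AE) (auto simp: prob_space)
  also have "\<dots> = ln c" using assms c by (simp add: prob_space c_def)
  finally show ?thesis by (simp add: c_def)
qed

lemma (in prob_space) le_ln_expectation_exp:
  fixes X :: "'a \<Rightarrow> real"
  assumes "integrable M X" "integrable M (\<lambda>\<omega>. exp (X \<omega>))"
  shows "expectation X \<le> ln (expectation (\<lambda>\<omega>. exp (X \<omega>)))"
proof -
  define c where "c = expectation X"
  have "exp c * (1 + (y - c)) \<le> exp y" for y
  proof -
    have "exp c * (1 + (y - c)) \<le> exp c * exp (y - c)"
      by (intro mult_left_mono exp_ge_add_one_self) auto
    then show ?thesis by (simp add: exp_add[symmetric])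
  qed
  then have "expectation (\<lambda>\<omega>. exp c * (1 + (X \<omega> - c))) \<le> expectation (\<lambda>\<omega>. exp (X \<omega>))"
    using assms by (intro integral_mono) auto
  also have "expectation (\<lambda>\<omega>. exp c * (1 + (X \<omega> - c))) = exp c"
    using assms by (simp add: prob_space c_def)
  finally have "exp c \<le> expectation (\<lambda>\<omega>. exp (X \<omega>))" .
  then show ?thesis
    by (metis c_def exp_gt_zero less_le_trans ln_exp ln_mono)
qed

section \<open>Exponential moments of Gaussian vectors and the error of one time step\<close>

lemma integrable_gauss1_exp_abs: "integrable gauss1 (\<lambda>g. exp (k * \<bar>g\<bar>))"
proof -
  have i: "integrable gauss1 (\<lambda>g. exp (k * g))" for k
    using nn_integral_gauss1_exp_quadratic[of 0 k] by (intro integrableI_nonneg) auto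
  show ?thesis
  proof (rule Bochner_Integration.integrable_bound[OF Bochner_Integration.integrable_add[OF i[of k] i[of "-k"]]])
    have "exp (k * \<bar>g\<bar>) \<le> exp (k * g) + exp (- k * g)" for g :: real
      by (cases "g \<ge> 0") auto
    then show "AE g in gauss1. norm (exp (k * \<bar>g\<bar>)) \<le> norm (exp (k * g) + exp (- k * g))"
      by (intro always_eventually allI) (metis abs_ge_self abs_exp_cancel order.trans real_norm_def)
  qed simp
qed

lemma integrable_gaussPi_exp_abs:
  assumes "finite I"
  shows "integrable (gaussPi I) (\<lambda>G. exp (k * (\<Sum>i\<in>I. \<bar>G i\<bar>)))"
proof -
  have "integrable (gaussPi I) (\<lambda>G. \<Prod>i\<in>I. exp (k * \<bar>G i\<bar>))"
    by (rule gauss_PiM.product_integrable_prod[OF assms integrable_gauss1_exp_abs])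
  then show ?thesis using assms by (simp add: exp_sum sum_distrib_left)
qed

lemma integrable_gaussPi_abs:
  assumes "finite I"
  shows "integrable (gaussPi I) (\<lambda>G. \<Sum>i\<in>I. \<bar>G i\<bar>)"
proof (rule Bochner_Integration.integrable_bound[OF integrable_gaussPi_exp_abs[OF assms, of 1]])
  show "AE G in gaussPi I. norm (\<Sum>i\<in>I. \<bar>G i\<bar>) \<le> norm (exp (1 * (\<Sum>i\<in>I. \<bar>G i\<bar>)))"
  proof (intro always_eventually allI)
    fix G :: "'a \<Rightarrow> real"
    have "(\<Sum>i\<in>I. \<bar>G i\<bar>) \<ge> 0" by (intro sum_nonneg) auto
    then show "norm (\<Sum>i\<in>I. \<bar>G i\<bar>) \<le> norm (exp (1 * (\<Sum>i\<in>I. \<bar>G i\<bar>)))"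
      using order.trans[OF _ exp_ge_add_one_self, of "\<Sum>i\<in>I. \<bar>G i\<bar>"] by simp
  qed
qed simp

text \<open>Times \<open>sqrt s\<close>, this bounds \<open>\<bar>ln Zf\<bar>\<close> over a time
  step \<open>s \<le> 1\<close>: the Gaussian part scales like \<open>sqrt s\<close>, and the
  variance part like \<open>s \<le> sqrt s\<close>.\<close>

definition step_radius :: "'i set \<Rightarrow> real \<Rightarrow> ('i \<Rightarrow> real) \<Rightarrow> real" where
  "step_radius I K G = K * (\<Sum>i\<in>I. \<bar>G i\<bar>) + real (card I) * K\<^sup>2 / 2"

text \<open>The error constant of one time step does not depend on the reference measure, so that it
  serves all Gibbs measures at once.\<close>

definition step_error :: "'i set \<Rightarrow> real \<Rightarrow> real" where
  "step_error I K = (\<integral>G. step_radius I K G ^ 3 * exp (4 * step_radius I K G) \<partial>gaussPi I)"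

lemma step_radius_nonneg: "K \<ge> 0 \<Longrightarrow> step_radius I K G \<ge> 0"
  unfolding step_radius_def by (intro add_nonneg_nonneg mult_nonneg_nonneg sum_nonneg) auto

lemma step_radius_measurable [measurable]: "step_radius I K \<in> borel_measurable (gaussPi I)"
  unfolding step_radius_def by measurable

lemma integrable_step_error:
  assumes "finite I" "K \<ge> 0"
  shows "integrable (gaussPi I) (\<lambda>G. step_radius I K G ^ 3 * exp (4 * step_radius I K G))"
proof -
  \<comment> \<open>The exponent is 7 = 3 + 4: the cube is at most \<open>exp (3 * y)\<close>, and
    \<open>exp (4 * y)\<close> is already there.\<close>
  have "integrable (gaussPi I) (\<lambda>G. exp (7 * (real (card I) * K\<^sup>2 / 2)) * exp ((7 * K) * (\<Sum>i\<in>I. \<bar>G i\<bar>)))"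
    by (intro integrable_mult_right integrable_gaussPi_exp_abs assms)
  then have i: "integrable (gaussPi I) (\<lambda>G. exp (7 * step_radius I K G))"
    by (simp add: step_radius_def exp_add[symmetric] algebra_simps)
  show ?thesis
  proof (rule Bochner_Integration.integrable_bound[OF i])
    show "AE G in gaussPi I. norm (step_radius I K G ^ 3 * exp (4 * step_radius I K G)) \<le> norm (exp (7 * step_radius I K G))"
    proof (intro always_eventually allI)
      fix G
      define y where "y = step_radius I K G"
      have y: "y \<ge> 0" by (simp add: y_def step_radius_nonneg assms)
      have "y ^ 3 \<le> exp y ^ 3"
        using y by (intro power_mono order.trans[OF _ exp_ge_add_one_self]) auto
      then have "y ^ 3 * exp (4 * y) \<le> exp (3 * y) * exp (4 * y)"
        by (intro mult_right_mono) (auto simp: exp_of_nat_mult[of 3, simplified])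
      then show "norm (step_radius I K G ^ 3 * exp (4 * step_radius I K G)) \<le> norm (exp (7 * step_radius I K G))"
        using y by (simp add: y_def exp_add[symmetric] abs_mult)
    qed
  qed measurable
qed

text \<open>With u = y - 1, the bound ln y \<ge> 1 - 1/y is combined with the exact expansion 1 -
  1/y = u - u^2 + u^3/y. The coefficient 1 of u^2, where Taylor has 1/2, only affects constants
  later.\<close>

lemma ln_ge_cubic:
  fixes y :: real
  assumes "y > 0"
  shows "(y - 1) - (y - 1)\<^sup>2 - \<bar>y - 1\<bar> ^ 3 / y \<le> ln y"
proof -
  have "- (\<bar>y - 1\<bar> ^ 3) \<le> (y - 1) ^ 3"
    by (metis abs_ge_minus_self minus_le_iff power_abs)
  then have "- (\<bar>y - 1\<bar> ^ 3) / y \<le> (y - 1) ^ 3 / y"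
    using assms by (intro divide_right_mono) auto
  then have "(y - 1) - (y - 1)\<^sup>2 - \<bar>y - 1\<bar> ^ 3 / y \<le> (y - 1) - (y - 1)\<^sup>2 + (y - 1) ^ 3 / y"
    by simp
  also have "\<dots> = 1 - 1 / y"
    using assms by (simp add: field_simps power2_eq_square power3_eq_cube)
  also have "\<dots> \<le> ln y"
    using ln_le_minus_one[of "1 / y"] assms by (simp add: ln_div)
  finally show ?thesis .
qed

text \<open>Here \<open>\<bar>y - 1\<bar> \<le> w * exp w\<close> and
  \<open>1 / y \<le> exp w\<close>; three factors of the first and one of the second give
  \<open>exp (4 * w)\<close>.\<close>

lemma ln_ge_of_exp_bounds:
  fixes y w :: real
  assumes w: "w \<ge> 0" and y: "exp (- w) \<le> y" "y \<le> exp w"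
  shows "(y - 1) - (y - 1)\<^sup>2 - w ^ 3 * exp (4 * w) \<le> ln y"
proof -
  have y0: "y > 0" using less_le_trans[OF exp_gt_zero y(1)] .
  have lo: "1 - w \<le> exp (- w)" using exp_ge_add_one_self[of "-w"] by simp
  have "exp w * (1 - w) \<le> exp w * exp (- w)" using lo by (intro mult_left_mono) auto
  then have hi: "exp w - 1 \<le> w * exp w" by (simp add: exp_add[symmetric] algebra_simps)
  have "w * 1 \<le> w * exp w" using w by (intro mult_left_mono) auto
  then have "\<bar>y - 1\<bar> \<le> w * exp w"
    using y lo hi by linarith
  then have "\<bar>y - 1\<bar> ^ 3 \<le> (w * exp w) ^ 3" by (intro power_mono) auto
  moreover have "1 / y \<le> exp w"
    using y(1) y0 by (simp add: exp_minus field_simps)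
  ultimately have "\<bar>y - 1\<bar> ^ 3 * (1 / y) \<le> (w * exp w) ^ 3 * exp w"
    using y0 w by (intro mult_mono) auto
  also have "\<dots> = w ^ 3 * exp (4 * w)"
    using exp_of_nat_mult[of 4 w] by (simp add: power_mult_distrib eval_nat_numeral)
  finally show ?thesis using ln_ge_cubic[OF y0] by simp
qed

subsection \<open>Gaussian fields over a probability space\<close>

text \<open>The Hamiltonian is the Gaussian combination of the features \<open>x i\<close>. Apart
  from total mass and measurability nothing refers to \<open>\<nu>\<close>, so the Gibbs measures of
  the model are again instances with the same \<open>I\<close>, \<open>x\<close> and
  \<open>K\<close>.\<close>

locale gaussian_field = prob_space \<nu> for \<nu> :: "'z measure" +
  fixes I :: "'i set" and x :: "'i \<Rightarrow> 'z \<Rightarrow> real" and K :: real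
  assumes finite_I: "finite I"
    and x_measurable [measurable]: "\<And>i. i \<in> I \<Longrightarrow> x i \<in> borel_measurable \<nu>"
    and K_nonneg: "K \<ge> 0"
    and x_bound: "\<And>i z. i \<in> I \<Longrightarrow> \<bar>x i z\<bar> \<le> K"
    and cov_nonneg': "\<And>z w. 0 \<le> (\<Sum>i\<in>I. x i z * x i w)"
begin

definition cov :: "'z \<Rightarrow> 'z \<Rightarrow> real" where
  "cov z w = (\<Sum>i\<in>I. x i z * x i w)"

text \<open>The subtracted half variance gives \<open>exp (W t h z)\<close> mean 1 when
  \<open>h\<close> is \<open>sqrt t\<close> times a standard Gaussian vector. Time and disorder are
  separate arguments so that a step can add \<open>s\<close> to one and an independent increment to
  the other.\<close>

definition W :: "real \<Rightarrow> ('i \<Rightarrow> real) \<Rightarrow> 'z \<Rightarrow> real" where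
  "W t h z = (\<Sum>i\<in>I. h i * x i z) - t / 2 * cov z z"

definition Zf :: "real \<Rightarrow> ('i \<Rightarrow> real) \<Rightarrow> real" where
  "Zf t h = (\<integral>z. exp (W t h z) \<partial>\<nu>)"

text \<open>Two replicas in the same disorder, coupled with strength \<open>r\<close>: divided by
  \<open>(Zf t h)\<^sup>2\<close> this is the Gibbs average of exp (r c).\<close>

definition Z2 :: "real \<Rightarrow> real \<Rightarrow> ('i \<Rightarrow> real) \<Rightarrow> real" where
  "Z2 r t h = (\<integral>p. exp (W t h (fst p) + W t h (snd p) + r * cov (fst p) (snd p)) \<partial>(\<nu> \<Otimes>\<^sub>M \<nu>))"

sublocale pair: pair_prob_space \<nu> \<nu> ..

lemma cov_nonneg: "0 \<le> cov z w"
  by (simp add: cov_def cov_nonneg')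

lemma cov_le: "cov z w \<le> real (card I) * K\<^sup>2"
proof -
  have "x i z * x i w \<le> K\<^sup>2" if "i \<in> I" for i
  proof -
    have "x i z * x i w \<le> \<bar>x i z\<bar> * \<bar>x i w\<bar>" by (simp add: abs_mult[symmetric])
    also have "\<dots> \<le> K * K" using x_bound[OF that] K_nonneg by (intro mult_mono) auto
    finally show ?thesis by (simp add: power2_eq_square)
  qed
  then have "cov z w \<le> (\<Sum>i\<in>I. K\<^sup>2)" unfolding cov_def by (intro sum_mono)
  then show ?thesis by simp
qed

lemma cov_measurable [measurable]:
  "(\<lambda>p. cov (f p) (g p)) \<in> borel_measurable M" if [measurable]: "f \<in> M \<rightarrow>\<^sub>M \<nu>" "g \<in> M \<rightarrow>\<^sub>M \<nu>"
  unfolding cov_def by measurable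

lemma W_measurable [measurable]:
  assumes [measurable]: "\<And>i. i \<in> I \<Longrightarrow> (\<lambda>p. h p i) \<in> borel_measurable M" "f \<in> M \<rightarrow>\<^sub>M \<nu>"
  shows "(\<lambda>p. W t (h p) (f p)) \<in> borel_measurable M"
  unfolding W_def by measurable

section \<open>A priori bounds, measurability and integrability\<close>

definition hbound :: "real \<Rightarrow> ('i \<Rightarrow> real) \<Rightarrow> real" where
  "hbound t h = K * (\<Sum>i\<in>I. \<bar>h i\<bar>) + t * (real (card I) * K\<^sup>2 / 2)"

lemma W_bound:
  assumes "t \<ge> 0"
  shows "\<bar>W t h z\<bar> \<le> hbound t h"
proof -
  have "\<bar>\<Sum>i\<in>I. h i * x i z\<bar> \<le> (\<Sum>i\<in>I. \<bar>h i\<bar> * K)"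
    by (intro order.trans[OF sum_abs] sum_mono) (auto simp: abs_mult intro!: mult_left_mono x_bound)
  then have 1: "\<bar>\<Sum>i\<in>I. h i * x i z\<bar> \<le> K * (\<Sum>i\<in>I. \<bar>h i\<bar>)"
    by (simp add: sum_distrib_left mult.commute)
  have "0 \<le> t / 2 * cov z z" using assms cov_nonneg by simp
  moreover have "t / 2 * cov z z \<le> t / 2 * (real (card I) * K\<^sup>2)"
    using assms cov_le by (intro mult_left_mono) auto
  ultimately show ?thesis using 1 unfolding W_def hbound_def by (auto simp: abs_le_iff)
qed

lemma integrable_exp_W: "t \<ge> 0 \<Longrightarrow> integrable \<nu> (\<lambda>z. exp (W t h z))"
  by (rule integrable_const_bound[where B="exp (hbound t h)"])
    (use W_bound[of t h] in \<open>auto simp: abs_le_iff\<close>)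

lemma Zf_bounds:
  assumes "t \<ge> 0"
  shows "exp (- hbound t h) \<le> Zf t h" "Zf t h \<le> exp (hbound t h)"
proof -
  have "(\<integral>z. exp (- hbound t h) \<partial>\<nu>) \<le> Zf t h"
    unfolding Zf_def using W_bound[OF assms, of h]
    by (intro integral_mono integrable_exp_W assms) (auto simp: abs_le_iff minus_le_iff)
  then show "exp (- hbound t h) \<le> Zf t h" by (simp add: prob_space)
  have "Zf t h \<le> (\<integral>z. exp (hbound t h) \<partial>\<nu>)"
    unfolding Zf_def using W_bound[OF assms, of h]
    by (intro integral_mono integrable_exp_W assms) (auto simp: abs_le_iff)
  then show "Zf t h \<le> exp (hbound t h)" by (simp add: prob_space)
qed

lemma Zf_pos: "t \<ge> 0 \<Longrightarrow> Zf t h > 0"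
  using less_le_trans[OF exp_gt_zero Zf_bounds(1)] .

lemma abs_ln_Zf_le: "t \<ge> 0 \<Longrightarrow> \<bar>ln (Zf t h)\<bar> \<le> hbound t h"
  using Zf_bounds[of t h] Zf_pos[of t h] ln_le_cancel_iff[of "Zf t h" "exp (hbound t h)"]
    ln_le_cancel_iff[of "exp (- hbound t h)" "Zf t h"] by (simp add: abs_le_iff)

lemma Zf_measurable [measurable]:
  assumes [measurable]: "\<And>i. i \<in> I \<Longrightarrow> (\<lambda>p. h p i) \<in> borel_measurable M"
  shows "(\<lambda>p. Zf t (h p)) \<in> borel_measurable M"
  unfolding Zf_def by measurable

lemma Z2_measurable [measurable]:
  assumes [measurable]: "\<And>i. i \<in> I \<Longrightarrow> (\<lambda>p. h p i) \<in> borel_measurable M"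
  shows "(\<lambda>p. Z2 r t (h p)) \<in> borel_measurable M"
  unfolding Z2_def by measurable

lemma integrable_exp_cov: "integrable (\<nu> \<Otimes>\<^sub>M \<nu>) (\<lambda>p. exp (r * cov (fst p) (snd p)))" if "r \<ge> 0"
  by (rule pair.integrable_const_bound[where B="exp (r * (real (card I) * K\<^sup>2))"])
    (use cov_le that in \<open>auto intro!: mult_left_mono\<close>)

lemma integrable_cov: "integrable (\<nu> \<Otimes>\<^sub>M \<nu>) (\<lambda>p. cov (fst p) (snd p))"
  by (rule pair.integrable_const_bound[where B="real (card I) * K\<^sup>2"])
    (use cov_le cov_nonneg in \<open>auto\<close>)

lemma integrable_ln_Zf:
  assumes "t \<ge> 0"
  shows "integrable (gaussPi I) (\<lambda>J. ln (Zf t (\<lambda>i. c * J i)))"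
proof (rule Bochner_Integration.integrable_bound)
  show "integrable (gaussPi I) (\<lambda>J. K * (\<bar>c\<bar> * (\<Sum>i\<in>I. \<bar>J i\<bar>)) + t * (real (card I) * K\<^sup>2 / 2))"
    by (intro Bochner_Integration.integrable_add integrable_mult_right integrable_gaussPi_abs finite_I) simp
  show "AE J in gaussPi I. norm (ln (Zf t (\<lambda>i. c * J i)))
      \<le> norm (K * (\<bar>c\<bar> * (\<Sum>i\<in>I. \<bar>J i\<bar>)) + t * (real (card I) * K\<^sup>2 / 2))"
    using abs_ln_Zf_le[OF assms, of "\<lambda>i. c * _ i"]
    by (intro always_eventually allI) (auto simp: hbound_def abs_mult sum_distrib_left[symmetric] intro: order.trans[OF _ abs_ge_self])
qed measurable

section \<open>First and second moments over the disorder\<close>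

lemma nn_integral_exp_W:
  assumes "t \<ge> 0"
  shows "(\<integral>\<^sup>+J. ennreal (exp (W t (\<lambda>i. sqrt t * J i) z)) \<partial>gaussPi I) = 1"
proof -
  have "(\<integral>\<^sup>+J. ennreal (exp (W t (\<lambda>i. sqrt t * J i) z)) \<partial>gaussPi I)
     = (\<integral>\<^sup>+J. ennreal (exp (- (t / 2 * cov z z))) * ennreal (exp (\<Sum>i\<in>I. (sqrt t * x i z) * J i)) \<partial>gaussPi I)"
    by (simp add: W_def ennreal_mult[symmetric] exp_add[symmetric] algebra_simps)
  also have "\<dots> = ennreal (exp (- (t / 2 * cov z z))) * ennreal (exp ((\<Sum>i\<in>I. (sqrt t * x i z)\<^sup>2) / 2))"
    by (subst nn_integral_cmult) (auto simp: nn_integral_PiM_exp_linear[OF finite_I])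
  also have "(\<Sum>i\<in>I. (sqrt t * x i z)\<^sup>2) = t * cov z z"
    using assms by (simp add: cov_def sum_distrib_left power_mult_distrib) (simp add: power2_eq_square)
  finally show ?thesis by (simp add: ennreal_mult[symmetric] exp_add[symmetric])
qed

text \<open>The variance of the summed exponents is
  \<open>t * (cov z z + cov w w + 2 * cov z w)\<close>. Half its diagonal part cancels the
  normalisation; the cross term remains, so that averaging over the disorder adds \<open>t\<close>
  to the coupling \<open>r\<close>.\<close>

lemma nn_integral_exp_W2:
  assumes "t \<ge> 0"
  shows "(\<integral>\<^sup>+J. ennreal (exp (W t (\<lambda>i. sqrt t * J i) z + W t (\<lambda>i. sqrt t * J i) w + r * cov z w)) \<partial>gaussPi I)
    = ennreal (exp ((t + r) * cov z w))"
proof -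
  define b where "b = r * cov z w - t / 2 * (cov z z + cov w w)"
  have "(\<integral>\<^sup>+J. ennreal (exp (W t (\<lambda>i. sqrt t * J i) z + W t (\<lambda>i. sqrt t * J i) w + r * cov z w)) \<partial>gaussPi I)
     = (\<integral>\<^sup>+J. ennreal (exp b) * ennreal (exp (\<Sum>i\<in>I. (sqrt t * (x i z + x i w)) * J i)) \<partial>gaussPi I)"
    by (simp add: W_def b_def ennreal_mult[symmetric] exp_add[symmetric] algebra_simps sum.distrib)
  also have "\<dots> = ennreal (exp b) * ennreal (exp ((\<Sum>i\<in>I. (sqrt t * (x i z + x i w))\<^sup>2) / 2))"
    by (subst nn_integral_cmult) (auto simp: nn_integral_PiM_exp_linear[OF finite_I])
  also have "(\<Sum>i\<in>I. (sqrt t * (x i z + x i w))\<^sup>2) = t * (cov z z + cov w w + 2 * cov z w)"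
    using assms by (simp add: cov_def sum_distrib_left power_mult_distrib power2_sum)
      (simp add: power2_eq_square algebra_simps sum.distrib sum_distrib_left)
  finally show ?thesis by (simp add: ennreal_mult[symmetric] exp_add[symmetric] b_def field_simps)
qed

lemma expectation_Zf:
  assumes "t \<ge> 0"
  shows "integrable (gaussPi I) (\<lambda>J. Zf t (\<lambda>i. sqrt t * J i))"
    and "(\<integral>J. Zf t (\<lambda>i. sqrt t * J i) \<partial>gaussPi I) = 1"
proof -
  let ?f = "\<lambda>p. exp (W t (\<lambda>i. sqrt t * fst p i) (snd p))"
  have m: "?f \<in> borel_measurable (gaussPi I \<Otimes>\<^sub>M \<nu>)" by measurable
  have g: "(\<integral>\<^sup>+G. ennreal (?f (G, w)) \<partial>gaussPi I) = ennreal 1" for w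
    using nn_integral_exp_W[OF assms] by simp
  note F = Fubini_nonneg[OF gauss_PiM.P.sigma_finite_measure_axioms sigma_finite_measure_axioms m _ g]
  show "integrable (gaussPi I) (\<lambda>J. Zf t (\<lambda>i. sqrt t * J i))"
    using F(2) by (simp add: Zf_def)
  show "(\<integral>J. Zf t (\<lambda>i. sqrt t * J i) \<partial>gaussPi I) = 1"
    using F(3) by (simp add: Zf_def prob_space)
qed

lemma expectation_Z2:
  assumes "t \<ge> 0" "r \<ge> 0"
  shows "integrable (gaussPi I) (\<lambda>J. Z2 r t (\<lambda>i. sqrt t * J i))"
    and "(\<integral>J. Z2 r t (\<lambda>i. sqrt t * J i) \<partial>gaussPi I) = (\<integral>p. exp ((t + r) * cov (fst p) (snd p)) \<partial>(\<nu> \<Otimes>\<^sub>M \<nu>))"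
proof -
  let ?f = "\<lambda>p. exp (W t (\<lambda>i. sqrt t * fst p i) (fst (snd p)) + W t (\<lambda>i. sqrt t * fst p i) (snd (snd p))
    + r * cov (fst (snd p)) (snd (snd p)))"
  have m: "?f \<in> borel_measurable (gaussPi I \<Otimes>\<^sub>M (\<nu> \<Otimes>\<^sub>M \<nu>))" by measurable
  have g: "(\<integral>\<^sup>+G. ennreal (?f (G, w)) \<partial>gaussPi I) = ennreal (exp ((t + r) * cov (fst w) (snd w)))" for w
    using nn_integral_exp_W2[OF assms(1)] by simp
  have "t + r \<ge> 0" using assms by simp
  note F = Fubini_nonneg[OF gauss_PiM.P.sigma_finite_measure_axioms pair.sigma_finite_measure_axioms m _ g
      integrable_exp_cov[OF this]]
  show "integrable (gaussPi I) (\<lambda>J. Z2 r t (\<lambda>i. sqrt t * J i))"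
    using F(2) by (simp add: Z2_def)
  show "(\<integral>J. Z2 r t (\<lambda>i. sqrt t * J i) \<partial>gaussPi I) = (\<integral>p. exp ((t + r) * cov (fst p) (snd p)) \<partial>(\<nu> \<Otimes>\<^sub>M \<nu>))"
    using F(3) by (simp add: Z2_def)
qed

lemma Z2_eq_iterated:
  assumes "t \<ge> 0" "r \<ge> 0"
  shows "Z2 r t h = (\<integral>z. exp (W t h z) * (\<integral>w. exp (W t h w) * exp (r * cov z w) \<partial>\<nu>) \<partial>\<nu>)"
    and "integrable (\<nu> \<Otimes>\<^sub>M \<nu>) (\<lambda>p. exp (W t h (fst p) + W t h (snd p) + r * cov (fst p) (snd p)))"
proof -
  have "W t h (fst p) + W t h (snd p) + r * cov (fst p) (snd p) \<le> hbound t h + hbound t h + r * (real (card I) * K\<^sup>2)" for p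
    using W_bound[OF assms(1), of h] cov_le assms(2)
    by (intro add_mono mult_left_mono) (auto simp: abs_le_iff)
  then show i: "integrable (\<nu> \<Otimes>\<^sub>M \<nu>) (\<lambda>p. exp (W t h (fst p) + W t h (snd p) + r * cov (fst p) (snd p)))"
    by (intro pair.integrable_const_bound[where B="exp (hbound t h + hbound t h + r * (real (card I) * K\<^sup>2))"]) auto
  show "Z2 r t h = (\<integral>z. exp (W t h z) * (\<integral>w. exp (W t h w) * exp (r * cov z w) \<partial>\<nu>) \<partial>\<nu>)"
    unfolding Z2_def pair.integral_fst'[OF i, symmetric] by (simp add: exp_add mult.assoc)
qed

lemma Z2_0: "t \<ge> 0 \<Longrightarrow> Z2 0 t h = (Zf t h)\<^sup>2"
  by (simp add: Z2_eq_iterated Zf_def power2_eq_square)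

lemma Zf_cong: "(\<And>i. i \<in> I \<Longrightarrow> h i = k i) \<Longrightarrow> Zf t h = Zf t k"
  unfolding Zf_def W_def by (simp cong: sum.cong)

text \<open>The smallness of \<open>s\<close> puts \<open>s * cov z w\<close> into [0, 1/2], where
  exp x \<le> 1 + 2 x. Jensen's inequality for \<open>exp\<close> then bounds the mean of
  \<open>r * cov\<close>.\<close>

lemma expectation_exp_cov_le:
  assumes "s > 0" "s * (real (card I) * K\<^sup>2) \<le> 1 / 2" "r > 0"
  shows "(\<integral>p. exp (s * cov (fst p) (snd p)) \<partial>(\<nu> \<Otimes>\<^sub>M \<nu>))
    \<le> 1 + 2 * s / r * ln (\<integral>p. exp (r * cov (fst p) (snd p)) \<partial>(\<nu> \<Otimes>\<^sub>M \<nu>))"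
proof -
  have "exp (s * cov z w) \<le> 1 + 2 * (s * cov z w)" for z w
  proof -
    have "s * cov z w \<le> s * (real (card I) * K\<^sup>2)" using assms cov_le by (intro mult_left_mono) auto
    moreover have "0 \<le> s * cov z w" using assms cov_nonneg by simp
    ultimately show ?thesis using exp_bound_lemma[of "s * cov z w"] assms(2) by simp
  qed
  then have "(\<integral>p. exp (s * cov (fst p) (snd p)) \<partial>(\<nu> \<Otimes>\<^sub>M \<nu>)) \<le> (\<integral>p. 1 + 2 * (s * cov (fst p) (snd p)) \<partial>(\<nu> \<Otimes>\<^sub>M \<nu>))"
    using assms
    by (intro integral_mono integrable_exp_cov Bochner_Integration.integrable_add integrable_mult_right
        integrable_cov pair.integrable_const) auto
  also have "\<dots> = 1 + 2 * s / r * (\<integral>p. r * cov (fst p) (snd p) \<partial>(\<nu> \<Otimes>\<^sub>M \<nu>))"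
    using assms integrable_cov by (simp add: pair.prob_space)
  also have "\<dots> \<le> 1 + 2 * s / r * ln (\<integral>p. exp (r * cov (fst p) (snd p)) \<partial>(\<nu> \<Otimes>\<^sub>M \<nu>))"
    using assms integrable_cov
    by (intro add_left_mono mult_left_mono pair.le_ln_expectation_exp integrable_exp_cov) auto
  finally show ?thesis .
qed

text \<open>A short step from time 0. The partition function has mean 1, so the linear term of the
  logarithm vanishes and the quadratic one is the second moment minus 1. The cubic remainder carries
  \<open>sqrt s\<close> cubed. Used with a Gibbs measure as reference, the same bound describes a
  step from any time.\<close>

lemma expectation_ln_Zf_ge:
  assumes s: "s > 0" "s \<le> 1" "s * (real (card I) * K\<^sup>2) \<le> 1 / 2" and r: "r > 0"
  shows "- (2 * s / r * ln (\<integral>p. exp (r * cov (fst p) (snd p)) \<partial>(\<nu> \<Otimes>\<^sub>M \<nu>))) - s * sqrt s * step_error I K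
    \<le> (\<integral>G. ln (Zf s (\<lambda>i. sqrt s * G i)) \<partial>gaussPi I)"
proof -
  define Y where "Y G = Zf s (\<lambda>i. sqrt s * G i)" for G
  define R where "R = step_radius I K"
  have s_le: "s \<le> sqrt s" using s by (simp add: real_le_rsqrt power2_eq_square mult_left_le_one_le)
  \<comment> \<open>The bracket is (Y - 1) - (Y - 1)^2 expanded, so that only the first two moments
    of Y have to be integrated.\<close>
  have low: "(3 * Y G - (Y G)\<^sup>2 - 2) - s * sqrt s * (R G ^ 3 * exp (4 * R G)) \<le> ln (Y G)" for G
  proof -
    define w where "w = sqrt s * R G"
    have R0: "R G \<ge> 0" by (simp add: R_def step_radius_nonneg K_nonneg)
    then have w0: "w \<ge> 0" using s by (simp add: w_def)
    have "hbound s (\<lambda>i. sqrt s * G i) \<le> w"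
    proof -
      have "s * (real (card I) * K\<^sup>2 / 2) \<le> sqrt s * (real (card I) * K\<^sup>2 / 2)"
        using s_le by (intro mult_right_mono) auto
      then show ?thesis
        using s by (simp add: hbound_def w_def R_def step_radius_def abs_mult sum_distrib_left[symmetric] algebra_simps)
    qed
    moreover have "exp (- hbound s (\<lambda>i. sqrt s * G i)) \<le> Y G" "Y G \<le> exp (hbound s (\<lambda>i. sqrt s * G i))"
      unfolding Y_def using s by (auto intro: Zf_bounds)
    ultimately have "exp (- w) \<le> Y G" "Y G \<le> exp w"
      by (meson exp_le_cancel_iff neg_le_iff_le order.trans)+
    from ln_ge_of_exp_bounds[OF w0 this]
    have 1: "3 * Y G - (Y G)\<^sup>2 - 2 - w ^ 3 * exp (4 * w) \<le> ln (Y G)"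
      by (simp add: power2_eq_square algebra_simps)
    have "w \<le> R G" unfolding w_def using s R0 by (simp add: mult_left_le_one_le)
    have "w ^ 3 = s * sqrt s * R G ^ 3"
      using s by (simp add: w_def power_mult_distrib power3_eq_cube)
    then have "w ^ 3 * exp (4 * w) \<le> (s * sqrt s * R G ^ 3) * exp (4 * R G)"
      using s R0 \<open>w \<le> R G\<close> by (intro mult_mono) auto
    then show ?thesis using 1 by simp
  qed
  have s0: "s \<ge> 0" using s by simp
  have iY: "integrable (gaussPi I) Y" "(\<integral>G. Y G \<partial>gaussPi I) = 1"
    unfolding Y_def using expectation_Zf[OF s0] by auto
  have iY2: "integrable (gaussPi I) (\<lambda>G. (Y G)\<^sup>2)"
    "(\<integral>G. (Y G)\<^sup>2 \<partial>gaussPi I) = (\<integral>p. exp (s * cov (fst p) (snd p)) \<partial>(\<nu> \<Otimes>\<^sub>M \<nu>))"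
    using expectation_Z2[OF s0, of 0] by (simp_all add: Z2_0 s0 Y_def)
  have iR: "integrable (gaussPi I) (\<lambda>G. R G ^ 3 * exp (4 * R G))"
    unfolding R_def by (rule integrable_step_error[OF finite_I K_nonneg])
  have "(\<integral>G. (3 * Y G - (Y G)\<^sup>2 - 2) - s * sqrt s * (R G ^ 3 * exp (4 * R G)) \<partial>gaussPi I)
      \<le> (\<integral>G. ln (Y G) \<partial>gaussPi I)"
  proof (intro integral_mono low)
    show "integrable (gaussPi I) (\<lambda>G. (3 * Y G - (Y G)\<^sup>2 - 2) - s * sqrt s * (R G ^ 3 * exp (4 * R G)))"
      using iY iY2 iR by simp
    show "integrable (gaussPi I) (\<lambda>G. ln (Y G))"
      unfolding Y_def by (rule integrable_ln_Zf[OF s0])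
  qed
  also have "(\<integral>G. (3 * Y G - (Y G)\<^sup>2 - 2) - s * sqrt s * (R G ^ 3 * exp (4 * R G)) \<partial>gaussPi I)
     = 1 - (\<integral>p. exp (s * cov (fst p) (snd p)) \<partial>(\<nu> \<Otimes>\<^sub>M \<nu>)) - s * sqrt s * step_error I K"
    using iY iY2 iR by (simp add: step_error_def R_def gauss_PiM.P.prob_space)
  finally show ?thesis
    using expectation_exp_cov_le[OF s(1,3) r] by (simp add: Y_def)
qed

section \<open>Gibbs measures as reference measures, and one step in a fixed disorder\<close>

definition gibbs :: "real \<Rightarrow> ('i \<Rightarrow> real) \<Rightarrow> 'z measure" where
  "gibbs t h = density \<nu> (\<lambda>z. ennreal (exp (W t h z) / Zf t h))"

lemma integral_gibbs:
  fixes f :: "'z \<Rightarrow> real"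
  assumes "t \<ge> 0" and [measurable]: "f \<in> borel_measurable \<nu>"
  shows "(\<integral>z. f z \<partial>gibbs t h) = (\<integral>z. exp (W t h z) * f z \<partial>\<nu>) / Zf t h"
  unfolding gibbs_def using Zf_pos[OF assms(1), of h]
  by (subst integral_density) (auto simp: less_imp_le)

text \<open>This transports the estimate for a step from time 0 to every later time, with
  \<open>step_error I K\<close> unchanged.\<close>

lemma gaussian_field_gibbs:
  assumes "t \<ge> 0"
  shows "gaussian_field (gibbs t h) I x K"
proof -
  have "(\<integral>\<^sup>+z. ennreal (exp (W t h z) / Zf t h) \<partial>\<nu>) = ennreal (\<integral>z. exp (W t h z) / Zf t h \<partial>\<nu>)"
    using Zf_pos[OF assms, of h] integrable_exp_W[OF assms, of h]
    by (intro nn_integral_eq_integral) (auto simp: less_imp_le)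
  also have "\<dots> = 1" using Zf_pos[OF assms, of h] by (simp flip: Zf_def)
  finally have "prob_space (gibbs t h)"
    by (intro prob_spaceI) (simp add: gibbs_def emeasure_density cong: nn_integral_cong)
  moreover have "x i \<in> borel_measurable (gibbs t h)" if "i \<in> I" for i
    using x_measurable[OF that] by (simp add: gibbs_def)
  ultimately show ?thesis
    using finite_I K_nonneg x_bound cov_nonneg'
    by (simp add: gaussian_field_def gaussian_field_axioms_def)
qed

text \<open>\<open>W\<close> is additive in the pair of time and disorder, so \<open>Zf\<close> at
  time \<open>t + s\<close> factors into \<open>Zf t h\<close> and the time-\<open>s\<close>
  partition function over the Gibbs measure. The two-replica average in the short-step bound becomes
  \<open>Z2 r t h / (Zf t h)\<^sup>2\<close>.\<close>

lemma gibbs_step: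
  assumes t: "t \<ge> 0" and s: "s > 0" "s \<le> 1" "s * (real (card I) * K\<^sup>2) \<le> 1 / 2" and r: "r > 0"
  shows "ln (Zf t h) - 2 * s / r * (ln (Z2 r t h) - 2 * ln (Zf t h)) - s * sqrt s * step_error I K
    \<le> (\<integral>G. ln (Zf (t + s) (\<lambda>i. h i + sqrt s * G i)) \<partial>gaussPi I)"
proof -
  interpret G: gaussian_field "gibbs t h" I x K by (rule gaussian_field_gibbs[OF t])
  have Zpos: "Zf t h > 0" by (rule Zf_pos[OF t])
  have mult: "Zf (t + s) (\<lambda>i. h i + k i) = Zf t h * G.Zf s k" for k
  proof -
    have "W (t + s) (\<lambda>i. h i + k i) z = W t h z + W s k z" for z
      by (simp add: W_def sum.distrib algebra_simps add_divide_distrib)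
    then show ?thesis
      unfolding G.Zf_def using Zpos by (subst integral_gibbs[OF t]) (auto simp: Zf_def exp_add)
  qed
  have "(\<integral>p. exp (r * cov (fst p) (snd p)) \<partial>(gibbs t h \<Otimes>\<^sub>M gibbs t h))
      = (\<integral>z. \<integral>w. exp (r * cov z w) \<partial>gibbs t h \<partial>gibbs t h)"
    by (subst G.pair.integral_fst'[symmetric]) (auto intro!: G.integrable_exp_cov less_imp_le r)
  also have "\<dots> = (\<integral>z. (\<integral>w. exp (W t h w) * exp (r * cov z w) \<partial>\<nu>) / Zf t h \<partial>gibbs t h)"
    by (intro Bochner_Integration.integral_cong refl integral_gibbs[OF t]) (simp add: gibbs_def)
  also have "\<dots> = Z2 r t h / (Zf t h)\<^sup>2"
    using r by (subst integral_gibbs[OF t]) (auto simp: Z2_eq_iterated[OF t] power2_eq_square)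
  finally have two: "(\<integral>p. exp (r * cov (fst p) (snd p)) \<partial>(gibbs t h \<Otimes>\<^sub>M gibbs t h)) = Z2 r t h / (Zf t h)\<^sup>2" .
  have "1 \<le> (\<integral>p. exp (r * cov (fst p) (snd p)) \<partial>(gibbs t h \<Otimes>\<^sub>M gibbs t h))"
    using r G.pair.integral_ge_const[OF G.integrable_exp_cov, of r 1] cov_nonneg by simp
  then have "Z2 r t h > 0" unfolding two using Zpos by (simp add: pos_le_divide_eq) (smt (verit) zero_less_power)
  then have "ln (Z2 r t h / (Zf t h)\<^sup>2) = ln (Z2 r t h) - 2 * ln (Zf t h)"
    using Zpos by (simp add: ln_div ln_realpow)
  moreover have "(\<integral>G. ln (Zf (t + s) (\<lambda>i. h i + sqrt s * G i)) \<partial>gaussPi I)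
      = ln (Zf t h) + (\<integral>G. ln (G.Zf s (\<lambda>i. sqrt s * G i)) \<partial>gaussPi I)"
  proof -
    have "ln (Zf (t + s) (\<lambda>i. h i + sqrt s * G i)) = ln (Zf t h) + ln (G.Zf s (\<lambda>i. sqrt s * G i))" for G
      using s by (simp add: mult[of "\<lambda>i. sqrt s * G i"] ln_mult_pos Zpos G.Zf_pos)
    then show ?thesis
      using s by (simp add: G.integrable_ln_Zf gauss_PiM.P.prob_space)
  qed
  ultimately show ?thesis
    using G.expectation_ln_Zf_ge[OF s r] two by simp
qed


section \<open>The averaged logarithm over time; \<open>- F t\<close> is the a(t) of the
  overview\<close>

definition F :: "real \<Rightarrow> real" where
  "F t = (\<integral>J. ln (Zf t (\<lambda>i. sqrt t * J i)) \<partial>gaussPi I)"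

lemma Z2_pos:
  assumes "t \<ge> 0" "r \<ge> 0"
  shows "(Zf t h)\<^sup>2 \<le> Z2 r t h" "Z2 r t h > 0"
proof -
  show le: "(Zf t h)\<^sup>2 \<le> Z2 r t h"
    unfolding Z2_0[OF assms(1), symmetric] unfolding Z2_def
    using assms cov_nonneg by (intro integral_mono Z2_eq_iterated) auto
  show "Z2 r t h > 0"
    using le Zf_pos[OF assms(1), of h] by (smt (verit) zero_less_power)
qed

text \<open>From below \<open>2 * ln Zf\<close> dominates, since a nonnegative covariance makes the
  coupled integral at least the square; from above \<open>Z2\<close> itself, whose mean is
  finite.\<close>

lemma integrable_ln_Z2:
  assumes "t \<ge> 0" "r \<ge> 0"
  shows "integrable (gaussPi I) (\<lambda>J. ln (Z2 r t (\<lambda>i. sqrt t * J i)))"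
proof (rule Bochner_Integration.integrable_bound)
  show "integrable (gaussPi I) (\<lambda>J. \<bar>2 * ln (Zf t (\<lambda>i. sqrt t * J i))\<bar> + \<bar>Z2 r t (\<lambda>i. sqrt t * J i)\<bar>)"
    using assms by (intro Bochner_Integration.integrable_add integrable_abs integrable_mult_right integrable_ln_Zf expectation_Z2)
  have "\<bar>ln (Z2 r t h)\<bar> \<le> \<bar>2 * ln (Zf t h)\<bar> + \<bar>Z2 r t h\<bar>" for h
  proof -
    have "ln ((Zf t h)\<^sup>2) \<le> ln (Z2 r t h)"
      using Z2_pos[OF assms, of h] Zf_pos[OF assms(1), of h] by (intro ln_mono) auto
    then have "2 * ln (Zf t h) \<le> ln (Z2 r t h)"
      using Zf_pos[OF assms(1), of h] by (simp add: ln_realpow)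
    moreover have "ln (Z2 r t h) \<le> Z2 r t h" using ln_le_minus_one[OF Z2_pos(2)[OF assms, of h]] by simp
    ultimately show ?thesis using Z2_pos(2)[OF assms, of h] by linarith
  qed
  then show "AE J in gaussPi I. norm (ln (Z2 r t (\<lambda>i. sqrt t * J i)))
      \<le> norm (\<bar>2 * ln (Zf t (\<lambda>i. sqrt t * J i))\<bar> + \<bar>Z2 r t (\<lambda>i. sqrt t * J i)\<bar>)"
    by (intro always_eventually allI) (auto intro: order.trans[OF _ abs_ge_self])
qed measurable

text \<open>\<open>sqrt (t + s)\<close> times a Gaussian has the law of \<open>sqrt t\<close> and \<open>sqrt s\<close> times two
  independent ones.\<close>

lemma F_add:
  assumes t: "t \<ge> 0" and s: "s > 0"
  shows "integrable (gaussPi I) (\<lambda>J. \<integral>G. ln (Zf (t + s) (\<lambda>i. sqrt t * J i + sqrt s * G i)) \<partial>gaussPi I)"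
    and "F (t + s) = (\<integral>J. \<integral>G. ln (Zf (t + s) (\<lambda>i. sqrt t * J i + sqrt s * G i)) \<partial>gaussPi I \<partial>gaussPi I)"
proof -
  interpret PP: pair_prob_space "gaussPi I" "gaussPi I" ..
  define a b where "a = sqrt (t / (t + s))" and "b = sqrt (s / (t + s))"
  have ab: "a\<^sup>2 + b\<^sup>2 = 1" "a \<ge> 0" "b > 0"
    using t s by (auto simp: a_def b_def add_divide_distrib[symmetric])
  define rot where "rot p = (\<lambda>i\<in>I. a * fst p i + b * snd p i)" for p :: "('i \<Rightarrow> real) \<times> ('i \<Rightarrow> real)"
  define g where "g J = ln (Zf (t + s) (\<lambda>i. sqrt (t + s) * J i))" for J
  have [measurable]: "rot \<in> gaussPi I \<Otimes>\<^sub>M gaussPi I \<rightarrow>\<^sub>M gaussPi I"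
    unfolding rot_def by (rule measurable_restrict) measurable
  have [measurable]: "g \<in> borel_measurable (gaussPi I)" unfolding g_def by measurable
  have rot: "distr (gaussPi I \<Otimes>\<^sub>M gaussPi I) (gaussPi I) rot = gaussPi I"
    unfolding rot_def by (rule distr_gaussPi_rotate[OF finite_I ab])
  have "integrable (gaussPi I) g"
    unfolding g_def using t s by (intro integrable_ln_Zf) auto
  then have i: "integrable (gaussPi I \<Otimes>\<^sub>M gaussPi I) (\<lambda>p. g (rot p))"
    by (subst (asm) rot[symmetric], subst (asm) integrable_distr_eq) auto
  have g: "g (rot (J, G)) = ln (Zf (t + s) (\<lambda>i. sqrt t * J i + sqrt s * G i))" for J G
    unfolding g_def using t s
    by (intro arg_cong[where f=ln] Zf_cong) (simp add: rot_def a_def b_def real_sqrt_divide field_simps)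
  show "integrable (gaussPi I) (\<lambda>J. \<integral>G. ln (Zf (t + s) (\<lambda>i. sqrt t * J i + sqrt s * G i)) \<partial>gaussPi I)"
    using PP.integrable_fst'[OF i] by (simp add: g)
  have "F (t + s) = (\<integral>J. g J \<partial>distr (gaussPi I \<Otimes>\<^sub>M gaussPi I) (gaussPi I) rot)"
    unfolding rot by (simp add: F_def g_def)
  also have "\<dots> = (\<integral>p. g (rot p) \<partial>(gaussPi I \<Otimes>\<^sub>M gaussPi I))"
    by (rule integral_distr) measurable
  finally show "F (t + s) = (\<integral>J. \<integral>G. ln (Zf (t + s) (\<lambda>i. sqrt t * J i + sqrt s * G i)) \<partial>gaussPi I \<partial>gaussPi I)"
    by (simp add: PP.integral_fst'[OF i, symmetric] g)
qed

text \<open>\<open>gibbs_step\<close> averaged over the disorder. Jensen's inequality replaces the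
  mean of \<open>ln Z2\<close> by the logarithm of an explicit double integral, while the
  normalisation \<open>2 * ln Zf\<close> averages to \<open>2 * F t\<close>. The recursion therefore
  involves no unknown but \<open>F\<close>.\<close>

lemma F_step:
  assumes t: "t \<ge> 0" and s: "s > 0" "s \<le> 1" "s * (real (card I) * K\<^sup>2) \<le> 1 / 2" and r: "r > 0"
  shows "F t - 2 * s / r * (ln (\<integral>p. exp ((t + r) * cov (fst p) (snd p)) \<partial>(\<nu> \<Otimes>\<^sub>M \<nu>)) - 2 * F t) - s * sqrt s * step_error I K
    \<le> F (t + s)"
proof -
  let ?Z = "\<lambda>J. Zf t (\<lambda>i. sqrt t * J i)" and ?Z2 = "\<lambda>J. Z2 r t (\<lambda>i. sqrt t * J i)"
  have r0: "r \<ge> 0" using r by simp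
  note iZ = integrable_ln_Zf[OF t, of "sqrt t"] and iZ2 = integrable_ln_Z2[OF t r0]
  have pos: "0 < (\<integral>p. exp ((t + r) * cov (fst p) (snd p)) \<partial>(\<nu> \<Otimes>\<^sub>M \<nu>))"
    using pair.integral_ge_const[OF integrable_exp_cov, of "t + r" 1] cov_nonneg t r by simp
  have "(\<integral>J. ln (?Z2 J) \<partial>gaussPi I) \<le> ln (\<integral>J. ?Z2 J \<partial>gaussPi I)"
    using Z2_pos(2)[OF t r0] pos
    by (intro gauss_PiM.P.expectation_ln_le expectation_Z2 iZ2) (auto simp: t r0 expectation_Z2)
  then have L: "(\<integral>J. ln (?Z2 J) \<partial>gaussPi I) \<le> ln (\<integral>p. exp ((t + r) * cov (fst p) (snd p)) \<partial>(\<nu> \<Otimes>\<^sub>M \<nu>))"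
    by (simp add: expectation_Z2 t r0)
  have "(\<integral>J. ln (?Z J) - 2 * s / r * (ln (?Z2 J) - 2 * ln (?Z J)) - s * sqrt s * step_error I K \<partial>gaussPi I)
    = F t - 2 * s / r * ((\<integral>J. ln (?Z2 J) \<partial>gaussPi I) - 2 * F t) - s * sqrt s * step_error I K"
    using iZ iZ2 by (simp add: F_def gauss_PiM.P.prob_space)
  moreover have "2 * s / r * (\<integral>J. ln (?Z2 J) \<partial>gaussPi I)
     \<le> 2 * s / r * ln (\<integral>p. exp ((t + r) * cov (fst p) (snd p)) \<partial>(\<nu> \<Otimes>\<^sub>M \<nu>))"
    using L s r by (intro mult_left_mono) auto
  moreover have "(\<integral>J. ln (?Z J) - 2 * s / r * (ln (?Z2 J) - 2 * ln (?Z J)) - s * sqrt s * step_error I K \<partial>gaussPi I) \<le> F (t + s)"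
    unfolding F_add(2)[OF t s(1)]
    using iZ iZ2 by (intro integral_mono F_add(1) t s gibbs_step r) auto
  ultimately show ?thesis by (simp add: right_diff_distrib)
qed

end

section \<open>Discrete Gronwall argument on the unit time interval\<close>

lemma (in gaussian_field) F_0: "F 0 = 0"
  by (simp add: F_def Zf_def W_def prob_space)

text \<open>With \<open>n\<close> steps of size 1/n each step multiplies \<open>- F\<close> by at
  most \<open>1 + 4 * s / r\<close>, in total by at most \<open>exp (4 / r)\<close>. The step errors
  add up to a multiple of \<open>sqrt (1 / n)\<close>, so \<open>n\<close> tending to infinity
  removes every dependence on \<open>I\<close> and \<open>K\<close> and leaves only \<open>B\<close>
  and \<open>r\<close>.\<close>

lemma (in gaussian_field) neg_F_one_le:
  assumes r: "r > 0" and B: "ln (\<integral>p. exp ((1 + r) * cov (fst p) (snd p)) \<partial>(\<nu> \<Otimes>\<^sub>M \<nu>)) \<le> B"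
  shows "- F 1 \<le> 2 * B / r * exp (4 / r)"
proof -
  define E where "E = step_error I K"
  have E0: "E \<ge> 0"
    unfolding E_def step_error_def by (intro integral_nonneg_AE) (auto simp: step_radius_nonneg K_nonneg)
  have mono: "ln (\<integral>p. exp (t * cov (fst p) (snd p)) \<partial>(\<nu> \<Otimes>\<^sub>M \<nu>)) \<le> B"
    "0 \<le> ln (\<integral>p. exp (t * cov (fst p) (snd p)) \<partial>(\<nu> \<Otimes>\<^sub>M \<nu>))" if t: "0 \<le> t" "t \<le> 1 + r" for t
  proof -
    have 1: "1 \<le> (\<integral>p. exp (t * cov (fst p) (snd p)) \<partial>(\<nu> \<Otimes>\<^sub>M \<nu>))"
      using pair.integral_ge_const[OF integrable_exp_cov, of t 1] cov_nonneg t by simp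
    then show "0 \<le> ln (\<integral>p. exp (t * cov (fst p) (snd p)) \<partial>(\<nu> \<Otimes>\<^sub>M \<nu>))" by simp
    have "(\<integral>p. exp (t * cov (fst p) (snd p)) \<partial>(\<nu> \<Otimes>\<^sub>M \<nu>)) \<le> (\<integral>p. exp ((1 + r) * cov (fst p) (snd p)) \<partial>(\<nu> \<Otimes>\<^sub>M \<nu>))"
      using t r cov_nonneg by (intro integral_mono integrable_exp_cov) (auto intro!: mult_right_mono)
    with 1 have "ln (\<integral>p. exp (t * cov (fst p) (snd p)) \<partial>(\<nu> \<Otimes>\<^sub>M \<nu>)) \<le> ln (\<integral>p. exp ((1 + r) * cov (fst p) (snd p)) \<partial>(\<nu> \<Otimes>\<^sub>M \<nu>))"
      by (intro ln_mono) auto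
    with B show "ln (\<integral>p. exp (t * cov (fst p) (snd p)) \<partial>(\<nu> \<Otimes>\<^sub>M \<nu>)) \<le> B" by simp
  qed
  have B0: "B \<ge> 0" using mono[of 0] r by linarith
  define C where "C n = 2 * B / r + sqrt (1 / real n) * E" for n
  \<comment> \<open>The second condition on \<open>n\<close> makes the step short enough for the
    linear bound on the exponential of the covariance.\<close>
  have bound: "- F 1 \<le> C n * exp (4 / r)" if n: "n > 0" "2 * real (card I) * K\<^sup>2 \<le> real n" for n
  proof -
    define s where "s = 1 / real n"
    have s: "s > 0" "s \<le> 1" "s * (real (card I) * K\<^sup>2) \<le> 1 / 2"
      using n by (auto simp: s_def field_simps)
    define q where "q = 1 + 4 * s / r"
    have q: "q \<ge> 1" using s r by (simp add: q_def)
    have C0: "C n \<ge> 0" using B0 r E0 by (simp add: C_def)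
    \<comment> \<open>Instead of a geometric sum, each of the \<open>k\<close> contributions is
      bounded by the largest power \<open>q ^ k\<close>; this is why \<open>q \<ge> 1\<close> is
      recorded.\<close>
    have "- F (real k * s) \<le> real k * s * C n * q ^ k" if "k \<le> n" for k
      using that
    proof (induction k)
      case 0
      then show ?case by (simp add: F_0)
    next
      case (Suc k)
      define t where "t = real k * s"
      have t: "t \<ge> 0" "t + r \<le> 1 + r" using s n Suc.prems by (auto simp: t_def s_def)
      have L: "ln (\<integral>p. exp ((t + r) * cov (fst p) (snd p)) \<partial>(\<nu> \<Otimes>\<^sub>M \<nu>)) \<le> B"
        using t r by (intro mono) auto
      have "2 * s / r * ln (\<integral>p. exp ((t + r) * cov (fst p) (snd p)) \<partial>(\<nu> \<Otimes>\<^sub>M \<nu>)) \<le> 2 * s / r * B"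
        using L s r by (intro mult_left_mono) auto
      then have "- F (t + s) \<le> q * (- F t) + s * C n"
        using F_step[OF t(1) s r] by (simp add: q_def C_def E_def s_def[symmetric] algebra_simps)
      also have "\<dots> \<le> q * (t * C n * q ^ k) + s * C n * q ^ Suc k"
      proof (intro add_mono mult_left_mono)
        show "- F t \<le> t * C n * q ^ k" using Suc by (simp add: t_def)
        show "s * C n \<le> s * C n * q ^ Suc k"
          using mult_left_mono[OF one_le_power[OF q, of "Suc k"], of "s * C n"] s C0 by simp
      qed (use q in auto)
      also have "\<dots> = real (Suc k) * s * C n * q ^ Suc k" by (simp add: t_def algebra_simps)
      finally show ?case by (simp add: t_def algebra_simps)
    qed
    from this[of n] have "- F 1 \<le> C n * q ^ n" using n by (simp add: s_def)
    also have "q ^ n \<le> exp (4 * s / r) ^ n"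
      using q by (intro power_mono) (auto simp: q_def)
    also have "exp (4 * s / r) ^ n = exp (4 / r)"
      using n by (simp add: exp_of_nat_mult[symmetric] s_def)
    finally show ?thesis using C0 by (simp add: mult_left_mono)
  qed
  have "(\<lambda>n. C n * exp (4 / r)) \<longlonglongrightarrow> (2 * B / r + sqrt 0 * E) * exp (4 / r)"
    unfolding C_def by (intro tendsto_intros lim_1_over_n)
  moreover have "\<exists>N. \<forall>n\<ge>N. - F 1 \<le> C n * exp (4 / r)"
  proof -
    obtain N :: nat where "2 * real (card I) * K\<^sup>2 \<le> real N" using real_arch_simple by blast
    then have "\<forall>n\<ge>Suc N. - F 1 \<le> C n * exp (4 / r)" by (auto intro!: bound)
    then show ?thesis ..
  qed
  ultimately show ?thesis by (intro LIMSEQ_le_const) simp_all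
qed

subsection \<open>The truncated model\<close>

lemma gaussPi_exp_sumsq:
  assumes "finite I" "\<alpha> < 1/2"
  shows "integrable (gaussPi I) (\<lambda>z. exp (\<alpha> * (\<Sum>i\<in>I. (z i)\<^sup>2)))"
    and "(\<integral>z. exp (\<alpha> * (\<Sum>i\<in>I. (z i)\<^sup>2)) \<partial>gaussPi I) = 1 / sqrt (1 - 2*\<alpha>) ^ card I"
proof -
  have nn: "(\<integral>\<^sup>+z. ennreal (exp (\<alpha> * (\<Sum>i\<in>I. (z i)\<^sup>2))) \<partial>gaussPi I) = ennreal (1 / sqrt (1 - 2*\<alpha>) ^ card I)"
    using nn_integral_PiM_exp_quadratic[OF assms, of "\<lambda>_. 0"] by simp
  then show "integrable (gaussPi I) (\<lambda>z. exp (\<alpha> * (\<Sum>i\<in>I. (z i)\<^sup>2)))"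
    by (intro integrableI_nonneg) auto
  show "(\<integral>z. exp (\<alpha> * (\<Sum>i\<in>I. (z i)\<^sup>2)) \<partial>gaussPi I) = 1 / sqrt (1 - 2*\<alpha>) ^ card I"
    using assms nn by (intro integral_eq_nn_integral[THEN trans]) auto
qed

text \<open>Once \<open>w\<close> is integrated out, the auxiliary variable has exponent
  \<open>\<kappa> * n / (1 - lam) * g\<^sup>2\<close>, with \<open>n\<close> the squared length of
  \<open>z\<close>. The hypothesis says exactly that this coefficient is below 1/2, which is why the
  length of \<open>z\<close> must be truncated.\<close>

lemma nn_integral_gaussPi_exp_inner_sq:
  assumes I: "finite I" and lam: "lam < 1" and \<kappa>: "\<kappa> \<ge> 0" "2 * \<kappa> * (\<Sum>i\<in>I. (z i)\<^sup>2) < 1 - lam"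
  shows "(\<integral>\<^sup>+w. ennreal (exp (lam / 2 * (\<Sum>i\<in>I. (w i)\<^sup>2) + \<kappa> * (\<Sum>i\<in>I. z i * w i)\<^sup>2)) \<partial>gaussPi I)
    = ennreal (1 / sqrt (1 - lam) ^ card I / sqrt (1 - 2 * \<kappa> * (\<Sum>i\<in>I. (z i)\<^sup>2) / (1 - lam)))"
proof -
  define n where "n = (\<Sum>i\<in>I. (z i)\<^sup>2)"
  define k where "k = sqrt (2 * \<kappa>)"
  have k2: "k\<^sup>2 = 2 * \<kappa>" using \<kappa> by (simp add: k_def)
  have "(\<integral>\<^sup>+w. ennreal (exp (lam / 2 * (\<Sum>i\<in>I. (w i)\<^sup>2) + \<kappa> * (\<Sum>i\<in>I. z i * w i)\<^sup>2)) \<partial>gaussPi I)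
     = (\<integral>\<^sup>+w. \<integral>\<^sup>+g. ennreal (exp (lam / 2 * (\<Sum>i\<in>I. (w i)\<^sup>2) + k * (\<Sum>i\<in>I. z i * w i) * g)) \<partial>gauss1 \<partial>gaussPi I)"
    \<comment> \<open>Hubbard-Stratonovich: the square in the exponent is linearised by an auxiliary Gaussian.\<close>
  proof (intro nn_integral_cong)
    fix w :: "'a \<Rightarrow> real"
    let ?y = "\<Sum>i\<in>I. z i * w i"
    have "(\<integral>\<^sup>+g. ennreal (exp (k * ?y * g)) \<partial>gauss1) = ennreal (exp (\<kappa> * ?y\<^sup>2))"
      using nn_integral_gauss1_exp_quadratic[of 0 "k * ?y"] by (simp add: power_mult_distrib k2)
    then show "ennreal (exp (lam / 2 * (\<Sum>i\<in>I. (w i)\<^sup>2) + \<kappa> * ?y\<^sup>2))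
      = (\<integral>\<^sup>+g. ennreal (exp (lam / 2 * (\<Sum>i\<in>I. (w i)\<^sup>2) + k * ?y * g)) \<partial>gauss1)"
      by (simp add: exp_add ennreal_mult nn_integral_cmult)
  qed
  also have "\<dots> = (\<integral>\<^sup>+g. \<integral>\<^sup>+w. ennreal (exp (lam / 2 * (\<Sum>i\<in>I. (w i)\<^sup>2) + (\<Sum>i\<in>I. (k * g * z i) * w i))) \<partial>gaussPi I \<partial>gauss1)"
    by (subst pair_sigma_finite.Fubini')
      (auto simp: pair_sigma_finite_def gauss1.sigma_finite_measure_axioms gauss_PiM.P.sigma_finite_measure_axioms
        sum_distrib_left sum_distrib_right ac_simps)
  also have "\<dots> = (\<integral>\<^sup>+g. ennreal (1 / sqrt (1 - lam) ^ card I) * ennreal (exp ((\<kappa> * n / (1 - lam)) * g\<^sup>2 + 0 * g)) \<partial>gauss1)"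
  proof (rule nn_integral_cong)
    fix g :: real
    have "(\<Sum>i\<in>I. (k * g * z i)\<^sup>2) = 2 * \<kappa> * g\<^sup>2 * n"
      by (simp add: power_mult_distrib k2 n_def sum_distrib_left)
    then have e: "(\<Sum>i\<in>I. (k * g * z i)\<^sup>2) / (2 - 2 * lam) = \<kappa> * n * g\<^sup>2 / (1 - lam)"
      using lam by (simp add: field_simps)
    show "(\<integral>\<^sup>+w. ennreal (exp (lam / 2 * (\<Sum>i\<in>I. (w i)\<^sup>2) + (\<Sum>i\<in>I. (k * g * z i) * w i))) \<partial>gaussPi I)
      = ennreal (1 / sqrt (1 - lam) ^ card I) * ennreal (exp ((\<kappa> * n / (1 - lam)) * g\<^sup>2 + 0 * g))"
      using nn_integral_PiM_exp_quadratic[OF I, of "lam / 2" "\<lambda>i. k * g * z i"] lam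
      by (simp add: ennreal_mult[symmetric] e)
  qed
  also have "\<dots> = ennreal (1 / sqrt (1 - lam) ^ card I) * ennreal (1 / sqrt (1 - 2 * (\<kappa> * n / (1 - lam))))"
    using \<kappa> lam by (subst nn_integral_cmult; (subst nn_integral_gauss1_exp_quadratic)?) (auto simp: n_def field_simps)
  finally show ?thesis
    using lam \<kappa> by (simp add: ennreal_mult[symmetric] n_def mult.assoc)
qed

section \<open>The Hamiltonian of the model and its annealed average\<close>

definition sumsq :: "nat \<Rightarrow> (nat \<Rightarrow> real) \<Rightarrow> real" where
  "sumsq N z = (\<Sum>i<N. (z i)\<^sup>2)"

lemma sumsq_measurable [measurable]: "sumsq N \<in> borel_measurable (gaussPi {..<N})"
  unfolding sumsq_def by measurable

lemma sumsq_nonneg: "sumsq N z \<ge> 0"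
  by (simp add: sumsq_def sum_nonneg)

lemma gaussVec_eq: "gaussVec N = gaussPi {..<N}"
  by (simp add: gaussVec_def)

lemma gaussDisorder_eq: "gaussDisorder N = gaussPi ({..<N} \<times> {..<N})"
  by (simp add: gaussDisorder_def)

lemma Hexp_eq:
  "Hexp N \<beta> lam J z = (\<Sum>p\<in>{..<N}\<times>{..<N}. (\<beta> / sqrt (2 * real N) * (z (fst p) * z (snd p))) * J p)
    - \<beta>\<^sup>2 / (4 * real N) * (sumsq N z)\<^sup>2 + lam / 2 * sumsq N z"
  by (simp add: Hexp_def sumsq_def sum.cartesian_product sum_distrib_left case_prod_unfold mult_ac)

lemma sum_prod_sq: "(\<Sum>p\<in>{..<N}\<times>{..<N}. (c * (z (fst p) * z (snd p)))\<^sup>2) = c\<^sup>2 * (sumsq N z)\<^sup>2"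
proof -
  have "(sumsq N z)\<^sup>2 = (\<Sum>p\<in>{..<N}\<times>{..<N}. (z (fst p))\<^sup>2 * (z (snd p))\<^sup>2)"
    unfolding sumsq_def power2_eq_square[of "sum _ _"]
    by (simp add: sum_product sum.cartesian_product case_prod_unfold)
  then show ?thesis by (simp add: power_mult_distrib sum_distrib_left)
qed

text \<open>Half the variance of the disorder term equals the subtracted quartic term, so only the
  quadratic tilt survives the average. The last conclusion confines to a null set the disorders for
  which \<open>Z\<close> takes the default value of a divergent integral.\<close>

lemma expectation_Z:
  assumes "lam < 1"
  shows "integrable (gaussDisorder N) (Z N \<beta> lam)"
    and "(\<integral>J. Z N \<beta> lam J \<partial>gaussDisorder N) = 1 / sqrt (1 - lam) ^ N"
    and "AE J in gaussDisorder N. integrable (gaussVec N) (\<lambda>z. exp (Hexp N \<beta> lam J z))"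
proof -
  interpret PP: pair_prob_space "gaussPi ({..<N} \<times> {..<N})" "gaussPi {..<N}" ..
  let ?f = "\<lambda>p. exp (Hexp N \<beta> lam (fst p) (snd p))"
  have m: "?f \<in> borel_measurable (gaussPi ({..<N} \<times> {..<N}) \<Otimes>\<^sub>M gaussPi {..<N})"
    unfolding Hexp_def by measurable
  have g: "(\<integral>\<^sup>+J. ennreal (?f (J, z)) \<partial>gaussPi ({..<N} \<times> {..<N})) = ennreal (exp (lam / 2 * sumsq N z))" for z
  proof -
    define b where "b = lam / 2 * sumsq N z - \<beta>\<^sup>2 / (4 * real N) * (sumsq N z)\<^sup>2"
    define c where "c = (\<lambda>p. \<beta> / sqrt (2 * real N) * (z (fst p) * z (snd p)))"
    have "(\<integral>\<^sup>+J. ennreal (?f (J, z)) \<partial>gaussPi ({..<N} \<times> {..<N}))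
      = (\<integral>\<^sup>+J. ennreal (exp b) * ennreal (exp (\<Sum>p\<in>{..<N}\<times>{..<N}. c p * J p)) \<partial>gaussPi ({..<N} \<times> {..<N}))"
      by (simp add: Hexp_eq b_def c_def ennreal_mult[symmetric] exp_add[symmetric] algebra_simps)
    also have "\<dots> = ennreal (exp b) * ennreal (exp ((\<Sum>p\<in>{..<N}\<times>{..<N}. (c p)\<^sup>2) / 2))"
      by (subst nn_integral_cmult) (auto simp: nn_integral_PiM_exp_linear)
    also have "(\<Sum>p\<in>{..<N}\<times>{..<N}. (c p)\<^sup>2) / 2 = \<beta>\<^sup>2 / (4 * real N) * (sumsq N z)\<^sup>2"
      unfolding c_def sum_prod_sq by (simp add: power_divide)
    finally show ?thesis by (simp add: ennreal_mult[symmetric] exp_add[symmetric] b_def)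
  qed
  have i: "integrable (gaussPi {..<N}) (\<lambda>z. exp (lam / 2 * sumsq N z))"
    and v: "(\<integral>z. exp (lam / 2 * sumsq N z) \<partial>gaussPi {..<N}) = 1 / sqrt (1 - lam) ^ N"
    using gaussPi_exp_sumsq[of "{..<N}" "lam / 2"] assms by (auto simp: sumsq_def)
  note F = Fubini_nonneg[OF gauss_PiM.P.sigma_finite_measure_axioms gauss_PiM.P.sigma_finite_measure_axioms m _ g i]
  show "integrable (gaussDisorder N) (Z N \<beta> lam)"
    using F(2) by (simp add: Z_def[abs_def] gaussVec_eq gaussDisorder_eq)
  show "(\<integral>J. Z N \<beta> lam J \<partial>gaussDisorder N) = 1 / sqrt (1 - lam) ^ N"
    using F(3) v by (simp add: Z_def gaussVec_eq gaussDisorder_eq)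
  show "AE J in gaussDisorder N. integrable (gaussVec N) (\<lambda>z. exp (Hexp N \<beta> lam J z))"
    using PP.AE_integrable_fst'[OF F(1)] unfolding gaussVec_eq gaussDisorder_eq by simp
qed

section \<open>Truncation to a ball and the tilted Gaussian law\<close>

definition tilt_mass :: "nat \<Rightarrow> real \<Rightarrow> real \<Rightarrow> real" where
  "tilt_mass N lam R = (\<integral>z. indicator {z. sumsq N z \<le> R} z * exp (lam / 2 * sumsq N z) \<partial>gaussPi {..<N})"

lemma integrable_tilt:
  assumes "lam < 1"
  shows "integrable (gaussPi {..<N}) (\<lambda>z. indicator {z. sumsq N z \<le> R} z * exp (lam / 2 * sumsq N z))"
proof (rule Bochner_Integration.integrable_bound)
  show "integrable (gaussPi {..<N}) (\<lambda>z. exp (lam / 2 * sumsq N z))"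
    using gaussPi_exp_sumsq[of "{..<N}" "lam / 2"] assms by (auto simp: sumsq_def)
  show "AE z in gaussPi {..<N}. norm (indicator {z. sumsq N z \<le> R} z * exp (lam / 2 * sumsq N z)) \<le> norm (exp (lam / 2 * sumsq N z))"
    by (auto simp: indicator_def)
qed measurable

text \<open>Chernoff bound: outside the ball, 1 is at most exp (\<delta> (|z|^2 - R)). Relative to
  the full tilted mass, the lost part is then at most \<open>q ^ N\<close>.\<close>

lemma tilt_mass_ge:
  assumes lam: "lam < 1" and \<eta>: "0 < \<eta>" "\<eta> < 1" and N: "N > 0"
    and q: "q = exp (- \<eta> * (1 + \<epsilon>) / 2) / sqrt (1 - \<eta>)" "q \<le> 1"
  shows "(1 - q) / sqrt (1 - lam) ^ N \<le> tilt_mass N lam (real N * (1 + \<epsilon>) / (1 - lam))"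
proof -
  define R where "R = real N * (1 + \<epsilon>) / (1 - lam)"
  \<comment> \<open>Chosen so that the Gaussian normalisation of the stronger tilt factors as
    \<open>(1 - lam) * (1 - \<eta>)\<close>.\<close>
  define \<delta> where "\<delta> = (1 - lam) * \<eta> / 2"
  have \<delta>: "\<delta> \<ge> 0" using lam \<eta> by (simp add: \<delta>_def)
  have eq: "1 - 2 * (lam / 2 + \<delta>) = (1 - lam) * (1 - \<eta>)" by (simp add: \<delta>_def field_simps)
  have "0 < (1 - lam) * (1 - \<eta>)" using lam \<eta> by simp
  then have "0 < 1 - 2 * (lam / 2 + \<delta>)" unfolding eq .
  then have lt: "lam / 2 + \<delta> < 1/2" by argo
  have i1: "integrable (gaussPi {..<N}) (\<lambda>z. exp (lam / 2 * sumsq N z))"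
    and v1: "(\<integral>z. exp (lam / 2 * sumsq N z) \<partial>gaussPi {..<N}) = 1 / sqrt (1 - lam) ^ N"
    using gaussPi_exp_sumsq[of "{..<N}" "lam / 2"] lam by (auto simp: sumsq_def)
  have i2: "integrable (gaussPi {..<N}) (\<lambda>z. exp ((lam / 2 + \<delta>) * sumsq N z))"
    and v2: "(\<integral>z. exp ((lam / 2 + \<delta>) * sumsq N z) \<partial>gaussPi {..<N}) = 1 / sqrt ((1 - lam) * (1 - \<eta>)) ^ N"
    using gaussPi_exp_sumsq[of "{..<N}" "lam / 2 + \<delta>"] lt unfolding eq by (auto simp: sumsq_def)
  have "exp (lam / 2 * sumsq N z) - exp (- \<delta> * R) * exp ((lam / 2 + \<delta>) * sumsq N z)
      \<le> indicator {z. sumsq N z \<le> R} z * exp (lam / 2 * sumsq N z)" for z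
  proof (cases "sumsq N z \<le> R")
    case False
    then have "lam / 2 * sumsq N z \<le> - \<delta> * R + (lam / 2 + \<delta>) * sumsq N z"
      using \<delta> mult_left_mono[of R "sumsq N z" \<delta>] by (simp add: algebra_simps)
    then show ?thesis using False by (simp add: exp_add[symmetric])
  qed simp
  then have "(\<integral>z. exp (lam / 2 * sumsq N z) - exp (- \<delta> * R) * exp ((lam / 2 + \<delta>) * sumsq N z) \<partial>gaussPi {..<N})
    \<le> tilt_mass N lam R"
    unfolding tilt_mass_def
    by (intro integral_mono Bochner_Integration.integrable_diff integrable_mult_right integrable_tilt i1 i2 lam)
  also have "(\<integral>z. exp (lam / 2 * sumsq N z) - exp (- \<delta> * R) * exp ((lam / 2 + \<delta>) * sumsq N z) \<partial>gaussPi {..<N})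
    = (1 - q ^ N) / sqrt (1 - lam) ^ N"
  proof -
    have "\<delta> * R = real N * (\<eta> * (1 + \<epsilon>) / 2)" using lam by (simp add: \<delta>_def R_def field_simps)
    then have "exp (- \<delta> * R) = exp (- \<eta> * (1 + \<epsilon>) / 2) ^ N"
      by (simp add: exp_of_nat_mult[symmetric])
    then show ?thesis
      unfolding Bochner_Integration.integral_diff[OF i1 integrable_mult_right[OF i2]]
        integral_mult_right_zero v1 v2
      by (simp add: q(1) power_divide real_sqrt_mult power_mult_distrib diff_divide_distrib mult.commute)
  qed
  finally have "(1 - q ^ N) / sqrt (1 - lam) ^ N \<le> tilt_mass N lam R" .
  \<comment> \<open>The weaker bound makes the retained fraction independent of
    \<open>N\<close>.\<close>
  moreover have "q ^ N \<le> q"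
  proof -
    have "q \<ge> 0" using \<eta> by (simp add: q(1))
    then show ?thesis using power_decreasing[of 1 N q] q(2) N by simp
  qed
  moreover from this have "(1 - q) / sqrt (1 - lam) ^ N \<le> (1 - q ^ N) / sqrt (1 - lam) ^ N"
    using lam by (intro divide_right_mono) auto
  ultimately show ?thesis unfolding R_def by linarith
qed

text \<open>The indicator in \<open>feature\<close> duplicates the support of \<open>tilted\<close>: it makes the
  features bounded everywhere, as \<open>gaussian_field\<close> demands.\<close>

definition tilted :: "nat \<Rightarrow> real \<Rightarrow> real \<Rightarrow> (nat \<Rightarrow> real) measure" where
  "tilted N lam R = density (gaussPi {..<N})
    (\<lambda>z. ennreal (indicator {z. sumsq N z \<le> R} z * exp (lam / 2 * sumsq N z) / tilt_mass N lam R))"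

definition feature :: "nat \<Rightarrow> real \<Rightarrow> real \<Rightarrow> nat \<times> nat \<Rightarrow> (nat \<Rightarrow> real) \<Rightarrow> real" where
  "feature N a R p z = a * (z (fst p) * z (snd p)) * indicator {z. sumsq N z \<le> R} z"

text \<open>The features are the entries of the tensor square of \<open>z\<close>, whose inner
  products are squares of inner products. This is the source of the nonnegative covariance.\<close>

lemma feature_cov:
  "(\<Sum>p\<in>{..<N}\<times>{..<N}. feature N a R p z * feature N a R p w)
    = a\<^sup>2 * (\<Sum>i<N. z i * w i)\<^sup>2 * (indicator {z. sumsq N z \<le> R} z * indicator {z. sumsq N z \<le> R} w)"
proof -
  have "(\<Sum>i<N. z i * w i)\<^sup>2 = (\<Sum>p\<in>{..<N}\<times>{..<N}. (z (fst p) * w (fst p)) * (z (snd p) * w (snd p)))"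
    unfolding power2_eq_square by (simp add: sum_product sum.cartesian_product case_prod_unfold)
  then show ?thesis
    by (simp add: feature_def sum_distrib_left sum_distrib_right power2_eq_square mult_ac)
qed

lemma gaussian_field_tilted:
  assumes lam: "lam < 1" and m: "tilt_mass N lam R > 0" and a: "a \<ge> 0" and R: "R \<ge> 0"
  shows "gaussian_field (tilted N lam R) ({..<N}\<times>{..<N}) (feature N a R) (a * R)"
proof -
  have "(\<integral>\<^sup>+z. ennreal (indicator {z. sumsq N z \<le> R} z * exp (lam / 2 * sumsq N z) / tilt_mass N lam R) \<partial>gaussPi {..<N})
    = ennreal (\<integral>z. indicator {z. sumsq N z \<le> R} z * exp (lam / 2 * sumsq N z) / tilt_mass N lam R \<partial>gaussPi {..<N})"
    using m integrable_tilt[OF lam, of N R] by (intro nn_integral_eq_integral) auto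
  also have "\<dots> = ennreal (tilt_mass N lam R / tilt_mass N lam R)"
    unfolding tilt_mass_def by (subst integral_divide_zero) (rule refl)
  also have "\<dots> = 1" using m by simp
  finally have "prob_space (tilted N lam R)"
    by (intro prob_spaceI) (simp add: tilted_def emeasure_density cong: nn_integral_cong)
  moreover have "feature N a R p \<in> borel_measurable (tilted N lam R)" if "p \<in> {..<N}\<times>{..<N}" for p
  proof -
    have [simp, measurable]: "fst p \<in> {..<N}" "snd p \<in> {..<N}" using that by auto
    have "feature N a R p \<in> borel_measurable (gaussPi {..<N})"
      unfolding feature_def[abs_def] by measurable
    then show ?thesis by (simp add: tilted_def)
  qed
  moreover have "\<bar>feature N a R p z\<bar> \<le> a * R" if p: "p \<in> {..<N}\<times>{..<N}" for p z
  proof (cases "sumsq N z \<le> R")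
    case True
    have le: "(z i)\<^sup>2 \<le> R" if "i < N" for i
      using member_le_sum[of i "{..<N}" "\<lambda>i. (z i)\<^sup>2"] that True by (simp add: sumsq_def)
    have "2 * (\<bar>z (fst p)\<bar> * \<bar>z (snd p)\<bar>) \<le> (z (fst p))\<^sup>2 + (z (snd p))\<^sup>2"
      using sum_squares_bound[of "\<bar>z (fst p)\<bar>" "\<bar>z (snd p)\<bar>"] by simp
    also have "\<dots> \<le> R + R" using p by (intro add_mono le) auto
    finally have "\<bar>z (fst p)\<bar> * \<bar>z (snd p)\<bar> \<le> R" by simp
    then show ?thesis using True a by (simp add: feature_def abs_mult mult_left_mono)
  next
    case False
    then show ?thesis using a R by (simp add: feature_def)
  qed
  ultimately show ?thesis
    using a R by (simp add: gaussian_field_def gaussian_field_axioms_def feature_cov)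
qed

text \<open>For \<open>z\<close> in the ball the \<open>w\<close>-integral is extended to the whole
  space, where it is explicit. The factor \<open>1 / c\<close> pays for the smaller normalising
  mass, and \<open>1 / sqrt (1 - \<rho>)\<close> is the worst case over the ball.\<close>

lemma exp_cov_tilted_le:
  assumes lam: "lam < 1" and a: "a \<ge> 0" and R: "R \<ge> 0" and c: "c > 0"
    and m: "c / sqrt (1 - lam) ^ N \<le> tilt_mass N lam R"
    and t: "t \<ge> 0" and \<rho>: "2 * (t * a\<^sup>2) * R \<le> \<rho> * (1 - lam)" "\<rho> < 1"
  shows "(\<integral>p. exp (t * gaussian_field.cov ({..<N}\<times>{..<N}) (feature N a R) (fst p) (snd p))
      \<partial>(tilted N lam R \<Otimes>\<^sub>M tilted N lam R)) \<le> 1 / (c * sqrt (1 - \<rho>))"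
proof -
  have M0: "0 < 1 / sqrt (1 - lam) ^ N" using lam by simp
  have "0 < c / sqrt (1 - lam) ^ N" using lam c by simp
  with m have mpos: "tilt_mass N lam R > 0" by linarith
  interpret gaussian_field "tilted N lam R" "{..<N}\<times>{..<N}" "feature N a R" "a * R"
    by (rule gaussian_field_tilted[OF lam mpos a R])
  define C where "C = 1 / (c * sqrt (1 - \<rho>))"
  have C: "C > 0" using c \<rho> by (simp add: C_def)
  let ?\<nu> = "tilted N lam R" and ?T = "{z. sumsq N z \<le> R}"
  have inner: "(\<integral>\<^sup>+w. ennreal (exp (t * cov z w)) \<partial>?\<nu>) \<le> ennreal C" if z: "sumsq N z \<le> R" for z
  proof -
    define \<kappa> where "\<kappa> = t * a\<^sup>2"
    define n where "n = sumsq N z"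
    have \<kappa>0: "\<kappa> \<ge> 0" using t by (simp add: \<kappa>_def)
    have "2 * \<kappa> * n \<le> 2 * \<kappa> * R" using z \<kappa>0 by (intro mult_left_mono) (auto simp: n_def)
    then have kn: "2 * \<kappa> * n \<le> \<rho> * (1 - lam)" using \<rho>(1) by (simp add: \<kappa>_def)
    moreover have "\<rho> * (1 - lam) < 1 * (1 - lam)" using lam \<rho>(2) by (intro mult_strict_right_mono) auto
    ultimately have kn1: "2 * \<kappa> * n < 1 - lam" by argo
    have kn2: "2 * \<kappa> * n / (1 - lam) \<le> \<rho>" using kn lam by (simp add: field_simps)
    then have kn3: "0 \<le> 1 - 2 * \<kappa> * n / (1 - lam)" using \<rho>(2) by linarith
    have meas: "(\<lambda>w. (\<Sum>i<N. z i * w i)) \<in> borel_measurable (gaussPi {..<N})" by measurable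
    note [measurable] = meas
    have covm[measurable]: "(\<lambda>w. cov z w) \<in> borel_measurable (gaussPi {..<N})"
      unfolding cov_def feature_cov by measurable
    have "(\<integral>\<^sup>+w. ennreal (exp (t * cov z w)) \<partial>?\<nu>)
      = (\<integral>\<^sup>+w. ennreal (indicator ?T w * exp (lam / 2 * sumsq N w) / tilt_mass N lam R) * ennreal (exp (t * cov z w)) \<partial>gaussPi {..<N})"
      unfolding tilted_def by (subst nn_integral_density) auto
    \<comment> \<open>The truncation of \<open>w\<close> is dropped here; that of \<open>z\<close>
      alone keeps the integral finite.\<close>
    also have "\<dots> \<le> (\<integral>\<^sup>+w. ennreal (1 / tilt_mass N lam R) * ennreal (exp (lam / 2 * sumsq N w + \<kappa> * (\<Sum>i<N. z i * w i)\<^sup>2)) \<partial>gaussPi {..<N})"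
      using mpos z
      by (intro nn_integral_mono) (auto simp: cov_def feature_cov indicator_def \<kappa>_def ennreal_mult[symmetric] exp_add mult_ac)
    also have "\<dots> = ennreal (1 / tilt_mass N lam R) * ennreal (1 / sqrt (1 - lam) ^ N / sqrt (1 - 2 * \<kappa> * n / (1 - lam)))"
      using nn_integral_gaussPi_exp_inner_sq[OF _ lam \<kappa>0, of "{..<N}" z] kn1
      by (subst nn_integral_cmult) (auto simp: sumsq_def n_def)
    also have "\<dots> \<le> ennreal C"
    proof -
      have "1 / sqrt (1 - lam) ^ N / sqrt (1 - 2 * \<kappa> * n / (1 - lam)) \<le> 1 / sqrt (1 - lam) ^ N / sqrt (1 - \<rho>)"
        using kn2 \<rho>(2) M0 by (intro divide_left_mono) (auto intro!: mult_pos_pos)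
      moreover have "1 / tilt_mass N lam R \<le> 1 / (c / sqrt (1 - lam) ^ N)"
        using m mpos lam c by (intro divide_left_mono) (auto intro!: mult_pos_pos)
      ultimately have "1 / tilt_mass N lam R * (1 / sqrt (1 - lam) ^ N / sqrt (1 - 2 * \<kappa> * n / (1 - lam)))
        \<le> 1 / (c / sqrt (1 - lam) ^ N) * (1 / sqrt (1 - lam) ^ N / sqrt (1 - \<rho>))"
        using mpos lam c kn3 by (intro mult_mono) (auto intro!: mult_nonneg_nonneg)
      also have "\<dots> = C" using lam by (simp add: C_def)
      finally show ?thesis
        using mpos lam kn3 by (subst ennreal_mult[symmetric]) (auto intro!: ennreal_leI)
    qed
    finally show ?thesis .
  qed
  \<comment> \<open>For \<open>z\<close> outside the ball the features vanish and the inner integral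
    is 1. That \<open>C\<close> covers this value follows from the bound at
    \<open>z = 0\<close>.\<close>
  have C1: "1 \<le> C"
  proof -
    have "ennreal 1 = (\<integral>\<^sup>+w. ennreal (exp (t * cov (\<lambda>_. 0) w)) \<partial>?\<nu>)"
      by (simp add: cov_def feature_cov emeasure_space_1)
    also have "\<dots> \<le> ennreal C" using R by (intro inner) (simp add: sumsq_def)
    finally show ?thesis using C by simp
  qed
  have "(\<integral>w. exp (t * cov z w) \<partial>?\<nu>) \<le> C" if zs: "z \<in> space ?\<nu>" for z
  proof (cases "sumsq N z \<le> R")
    case True
    have [measurable]: "z \<in> space ?\<nu>" by (rule zs)
    have "integrable ?\<nu> (\<lambda>w. exp (t * cov z w))"
      using cov_le t by (intro integrable_const_bound[where B="exp (t * (real (card ({..<N}\<times>{..<N})) * (a * R)\<^sup>2))"])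
        (auto intro!: mult_left_mono)
    then have "ennreal (\<integral>w. exp (t * cov z w) \<partial>?\<nu>) = (\<integral>\<^sup>+w. ennreal (exp (t * cov z w)) \<partial>?\<nu>)"
      by (intro nn_integral_eq_integral[symmetric]) auto
    also have "\<dots> \<le> ennreal C" by (rule inner[OF True])
    finally show ?thesis using C by simp
  next
    case False
    then show ?thesis using C1 by (simp add: cov_def feature_cov prob_space)
  qed
  then have "(\<integral>z. \<integral>w. exp (t * cov z w) \<partial>?\<nu> \<partial>?\<nu>) \<le> C"
    using pair.integrable_fst'[OF integrable_exp_cov[OF t]]
    by (intro integral_le_const) auto
  then show ?thesis
    using pair.integral_fst'[OF integrable_exp_cov[OF t]] by (simp add: C_def)
qed

text \<open>On the ball the features are those of the original Hamiltonian, and multiplying by the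
  mass undoes the normalisation, so the left side is the integral of \<open>Z\<close> restricted to
  the ball. Integrability is assumed because a divergent integral would make \<open>Z\<close> equal
  0.\<close>

lemma Z_ge:
  assumes lam: "lam < 1" and m: "tilt_mass N lam R > 0" and \<beta>: "\<beta> > 0" and N: "N > 0"
    and int: "integrable (gaussVec N) (\<lambda>z. exp (Hexp N \<beta> lam J z))"
  shows "tilt_mass N lam R * gaussian_field.Zf (tilted N lam R) ({..<N}\<times>{..<N}) (feature N (\<beta> / sqrt (2 * real N)) R) 1 J
    \<le> Z N \<beta> lam J"
proof -
  define a where "a = \<beta> / sqrt (2 * real N)"
  have a2: "a\<^sup>2 = \<beta>\<^sup>2 / (2 * real N)" "a \<ge> 0" using \<beta> by (auto simp: a_def power_divide)
  let ?T = "{z. sumsq N z \<le> R}"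
  \<comment> \<open>For negative \<open>R\<close> the ball is empty and its mass 0, contrary to
    \<open>m\<close>.\<close>
  have "sumsq N (\<lambda>_. 0) \<le> R"
  proof (rule ccontr)
    assume "\<not> ?thesis"
    then have "R < 0" by (simp add: sumsq_def)
    then have "sumsq N z > R" for z using sumsq_nonneg[of N z] by linarith
    then have "tilt_mass N lam R = 0" by (simp add: tilt_mass_def not_le[symmetric])
    then show False using m by simp
  qed
  then have R: "R \<ge> 0" by (simp add: sumsq_def)
  interpret gaussian_field "tilted N lam R" "{..<N}\<times>{..<N}" "feature N a R" "a * R"
    by (intro gaussian_field_tilted lam m R a2)
  have W: "W 1 J z + lam / 2 * sumsq N z = Hexp N \<beta> lam J z" if "sumsq N z \<le> R" for z
  proof -
    have "cov z z = a\<^sup>2 * (sumsq N z)\<^sup>2"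
      using that by (simp add: cov_def feature_cov sumsq_def power2_eq_square)
    then show ?thesis
      using that by (simp add: W_def Hexp_eq[of N \<beta> lam, folded a_def] feature_def a2 mult_ac)
  qed
  have "W 1 J \<in> borel_measurable (tilted N lam R)" by measurable
  then have [measurable]: "W 1 J \<in> borel_measurable (gaussPi {..<N})" by (simp add: tilted_def)
  have "tilt_mass N lam R * Zf 1 J
    = tilt_mass N lam R * (\<integral>z. indicator ?T z * exp (lam / 2 * sumsq N z) / tilt_mass N lam R * exp (W 1 J z) \<partial>gaussPi {..<N})"
    unfolding Zf_def using m by (subst tilted_def, subst integral_density) auto
  also have "\<dots> = (\<integral>z. indicator ?T z * exp (Hexp N \<beta> lam J z) \<partial>gaussPi {..<N})"
    using m by (subst integral_mult_right_zero[symmetric], intro Bochner_Integration.integral_cong)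
      (auto simp: W[symmetric] indicator_def exp_add)
  also have "\<dots> \<le> Z N \<beta> lam J"
    unfolding Z_def gaussVec_eq
  proof (intro integral_mono)
    show i: "integrable (gaussPi {..<N}) (\<lambda>z. exp (Hexp N \<beta> lam J z))" using int by (simp add: gaussVec_eq)
    show "integrable (gaussPi {..<N}) (\<lambda>z. indicator ?T z * exp (Hexp N \<beta> lam J z))"
      using borel_measurable_integrable[OF i]
      by (intro Bochner_Integration.integrable_bound[OF i]) (auto simp: indicator_def)
  qed (auto simp: indicator_def)
  finally show ?thesis by (simp only: a_def)
qed

subsection \<open>The quenched pressure\<close>

text \<open>Squared, the claim reads exp (- \<eta> (1 + \<epsilon>)) < 1 - \<eta>. It holds for
  small \<eta> because the left side has slope - (1 + \<epsilon>) at 0, steeper than - 1.\<close>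

lemma exists_chernoff_rate:
  fixes \<epsilon> :: real
  assumes "\<epsilon> > 0"
  obtains \<eta> where "0 < \<eta>" "\<eta> < 1" "exp (- \<eta> * (1 + \<epsilon>) / 2) / sqrt (1 - \<eta>) < 1"
proof
  \<comment> \<open>With this choice \<open>y = \<epsilon> / 2\<close>, and exp y \<ge> 1 + y
    reduces the claim to 1 + \<epsilon>/2 < 1 + \<epsilon>.\<close>
  define \<eta> where "\<eta> = \<epsilon> / (2 * (1 + \<epsilon>))"
  show \<eta>: "0 < \<eta>" "\<eta> < 1" using assms by (auto simp: \<eta>_def field_simps)
  define y where "y = \<eta> * (1 + \<epsilon>)"
  have y: "y = \<epsilon> / 2" using assms by (simp add: y_def \<eta>_def field_simps)
  have "1 < (1 - \<eta>) * (1 + y)"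
  proof -
    have "\<eta> * (1 + y) < y"
    proof -
      have "\<eta> * (1 + y) \<le> \<epsilon> / (2 * (1 + \<epsilon>)) * (1 + y)" by (simp add: \<eta>_def)
      also have "\<dots> < \<epsilon> / (2 * (1 + \<epsilon>)) * (1 + \<epsilon>)"
        using assms y by (intro mult_strict_left_mono) auto
      also have "\<dots> = y"
      proof -
        have "1 + \<epsilon> \<noteq> 0" using assms by simp
        then show ?thesis unfolding y by (metis divide_divide_eq_left' mult.commute nonzero_eq_divide_eq)
      qed
      finally show ?thesis .
    qed
    then show ?thesis by (simp add: algebra_simps)
  qed
  also have "\<dots> \<le> (1 - \<eta>) * exp y"
    using \<eta> by (intro mult_left_mono exp_ge_add_one_self) auto
  finally have "exp (- y) < 1 - \<eta>" by (simp add: exp_minus field_simps)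
  moreover have "exp (- \<eta> * (1 + \<epsilon>) / 2) = sqrt (exp (- y))"
  proof -
    have "exp (- y) = (exp (- \<eta> * (1 + \<epsilon>) / 2))\<^sup>2"
      by (simp add: power2_eq_square exp_add[symmetric] y_def)
    then show ?thesis by simp
  qed
  ultimately show "exp (- \<eta> * (1 + \<epsilon>) / 2) / sqrt (1 - \<eta>) < 1"
    using \<eta> by simp
qed

text \<open>The constant \<open>c\<close> is chosen before \<open>N\<close>: the quenched and
  annealed logarithms differ by a bounded amount, so the pressures differ by O(1/N).\<close>

lemma quenchedPressure_bounds:
  assumes lam: "lam < 1" and \<beta>: "0 < \<beta>" and less: "\<beta> < 1 - lam"
  shows "\<exists>c. \<forall>N>0. quenchedPressure N \<beta> lam \<le> - (1/2) * ln (1 - lam) \<and>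
    - (1/2) * ln (1 - lam) - c / real N \<le> quenchedPressure N \<beta> lam"
proof -
  define b where "b = \<beta> / (1 - lam)"
  have b: "0 < b" "b < 1" using lam \<beta> less by (auto simp: b_def)
  \<comment> \<open>This makes \<open>(1 + r) * b\<close> the midpoint of \<open>b\<close> and
    1.\<close>
  define r where "r = (1 / b - 1) / 2"
  have r: "r > 0" using b by (simp add: r_def)
  have rb: "(1 + r) * b < 1" "0 < (1 + r) * b" using b r by (simp add: r_def field_simps) (use b r in simp)
  \<comment> \<open>The square has two sources: one factor \<open>1 + r\<close> comes from the
    enlarged radius, the other from the coupling at the final time.\<close>
  define \<rho> where "\<rho> = ((1 + r) * b)\<^sup>2"
  have \<rho>: "\<rho> < 1" unfolding \<rho>_def using rb by (intro power_less_one_iff[THEN iffD2]) auto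
  obtain \<eta> where \<eta>: "0 < \<eta>" "\<eta> < 1" "exp (- \<eta> * (1 + r) / 2) / sqrt (1 - \<eta>) < 1"
    using exists_chernoff_rate[OF r] .
  define q where "q = exp (- \<eta> * (1 + r) / 2) / sqrt (1 - \<eta>)"
  have q: "q < 1" "q \<le> 1" using \<eta>(3) by (auto simp: q_def)
  define B where "B = ln (1 / ((1 - q) * sqrt (1 - \<rho>)))"
  \<comment> \<open>The first term is the Gronwall bound on \<open>- F 1\<close>, the second the
    logarithm of the mass fraction kept by the truncation.\<close>
  define c where "c = 2 * B / r * exp (4 / r) - ln (1 - q)"
  have *: "quenchedPressure N \<beta> lam \<le> - (1/2) * ln (1 - lam) \<and>
      - (1/2) * ln (1 - lam) - c / real N \<le> quenchedPressure N \<beta> lam" if N: "N > 0" for N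
  proof -
    define R where "R = real N * (1 + r) / (1 - lam)"
    define a where "a = \<beta> / sqrt (2 * real N)"
    define m where "m = tilt_mass N lam R"
    have R: "R \<ge> 0" using lam r by (simp add: R_def)
    have a: "a \<ge> 0" "a\<^sup>2 = \<beta>\<^sup>2 / (2 * real N)" using \<beta> by (auto simp: a_def power_divide)
    have m_ge: "(1 - q) / sqrt (1 - lam) ^ N \<le> m"
      unfolding m_def R_def by (rule tilt_mass_ge[OF lam \<eta>(1,2) N q_def q(2)])
    moreover have M0: "0 < (1 - q) / sqrt (1 - lam) ^ N" using q lam by simp
    ultimately have m: "m > 0" by linarith
    interpret gaussian_field "tilted N lam R" "{..<N}\<times>{..<N}" "feature N a R" "a * R"
      using m unfolding m_def by (intro gaussian_field_tilted lam a R)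
    define L where "L = 1 - lam"
    have "L > 0" using lam by (simp add: L_def)
    then have "2 * ((1 + r) * a\<^sup>2) * R = \<rho> * (1 - lam)"
      unfolding a R_def \<rho>_def b_def L_def[symmetric] using N by (simp add: power2_eq_square field_simps)
    then have "(\<integral>p. exp ((1 + r) * cov (fst p) (snd p)) \<partial>(tilted N lam R \<Otimes>\<^sub>M tilted N lam R)) \<le> 1 / ((1 - q) * sqrt (1 - \<rho>))"
      using m_ge r q by (intro exp_cov_tilted_le lam a R \<rho>) (auto simp: m_def)
    moreover have "0 < (\<integral>p. exp ((1 + r) * cov (fst p) (snd p)) \<partial>(tilted N lam R \<Otimes>\<^sub>M tilted N lam R))"
      using pair.integral_ge_const[OF integrable_exp_cov, of "1 + r" 1] cov_nonneg r by simp
    ultimately have "ln (\<integral>p. exp ((1 + r) * cov (fst p) (snd p)) \<partial>(tilted N lam R \<Otimes>\<^sub>M tilted N lam R)) \<le> B"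
      unfolding B_def by (intro ln_mono)
    then have F1: "- F 1 \<le> 2 * B / r * exp (4 / r)" by (rule neg_F_one_le[OF r])
    have iZf: "integrable (gaussDisorder N) (\<lambda>J. ln (Zf 1 J))"
      using integrable_ln_Zf[of 1 1] by (simp add: gaussDisorder_eq)
    have F: "F 1 = (\<integral>J. ln (Zf 1 J) \<partial>gaussDisorder N)"
      by (simp add: F_def gaussDisorder_eq)
    have ge: "AE J in gaussDisorder N. m * Zf 1 J \<le> Z N \<beta> lam J"
      using expectation_Z(3)[OF lam, where N=N and \<beta>=\<beta>]
    proof eventually_elim
      case (elim J)
      then show ?case
        using Z_ge[OF lam _ \<beta> N, of R J] m by (simp add: m_def a_def)
    qed
    have ge': "AE J in gaussDisorder N. 0 < Z N \<beta> lam J \<and> ln m + ln (Zf 1 J) \<le> ln (Z N \<beta> lam J)"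
      using ge
    proof eventually_elim
      case (elim J)
      have pos: "0 < m * Zf 1 J" using m Zf_pos[of 1 J] by simp
      then have "ln (m * Zf 1 J) \<le> ln (Z N \<beta> lam J)" using elim by (intro ln_mono) auto
      then show ?case using less_le_trans[OF pos elim] m Zf_pos[of 1 J] by (simp add: ln_mult_pos)
    qed
    have iZ: "integrable (gaussDisorder N) (Z N \<beta> lam)" by (rule expectation_Z(1)[OF lam])
    have [measurable]: "Z N \<beta> lam \<in> borel_measurable (gaussDisorder N)" using iZ by auto
    interpret D: prob_space "gaussDisorder N"
      unfolding gaussDisorder_eq by (rule gauss_PiM.P.prob_space_axioms)
    \<comment> \<open>The lower bound by the truncated model controls the negative part of the
      logarithm, and ln y \<le> y the positive part.\<close>
    have ilnZ: "integrable (gaussDisorder N) (\<lambda>J. ln (Z N \<beta> lam J))"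
    proof (rule Bochner_Integration.integrable_bound)
      show "integrable (gaussDisorder N) (\<lambda>J. \<bar>ln m + ln (Zf 1 J)\<bar> + \<bar>Z N \<beta> lam J\<bar>)"
        using iZf iZ by (intro Bochner_Integration.integrable_add integrable_abs) auto
      show "AE J in gaussDisorder N. norm (ln (Z N \<beta> lam J)) \<le> norm (\<bar>ln m + ln (Zf 1 J)\<bar> + \<bar>Z N \<beta> lam J\<bar>)"
        using ge'
      proof eventually_elim
        case (elim J)
        then show ?case using ln_le_minus_one[of "Z N \<beta> lam J"] by (simp add: abs_le_iff) linarith
      qed
    qed measurable
    define P where "P = (\<integral>J. ln (Z N \<beta> lam J) \<partial>gaussDisorder N)"
    have ln_sqrt_pow: "ln (1 / sqrt (1 - lam) ^ N) = real N * (- (1/2) * ln (1 - lam))"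
      using lam by (simp add: ln_div ln_realpow ln_sqrt)
    have "P \<le> ln (\<integral>J. Z N \<beta> lam J \<partial>gaussDisorder N)"
      unfolding P_def using lam ge'
      by (intro D.expectation_ln_le iZ ilnZ) (auto simp: expectation_Z elim: eventually_mono)
    then have up: "P \<le> real N * (- (1/2) * ln (1 - lam))"
      using ln_sqrt_pow by (simp add: expectation_Z(2)[OF lam])
    have "(\<integral>J. ln m + ln (Zf 1 J) \<partial>gaussDisorder N) \<le> P"
      unfolding P_def using ge' iZf ilnZ
      by (intro integral_mono_AE) (auto elim: eventually_mono)
    then have "ln m + F 1 \<le> P" using iZf by (simp add: F D.prob_space)
    moreover have "ln ((1 - q) / sqrt (1 - lam) ^ N) \<le> ln m"
      using m_ge M0 by (intro ln_mono)
    moreover have "ln ((1 - q) / sqrt (1 - lam) ^ N) = ln (1 - q) + real N * (- (1/2) * ln (1 - lam))"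
      using ln_sqrt_pow q lam by (simp add: ln_div)
    ultimately have low: "real N * (- (1/2) * ln (1 - lam)) - c \<le> P"
      using F1 unfolding c_def by linarith
    have "quenchedPressure N \<beta> lam = P / real N" by (simp add: quenchedPressure_def P_def)
    moreover have "P / real N \<le> - (1/2) * ln (1 - lam)"
      using up N by (subst pos_divide_le_eq) (auto simp: mult.commute)
    moreover have "(real N * (- (1/2) * ln (1 - lam)) - c) / real N \<le> P / real N"
      using low by (rule divide_right_mono) simp
    ultimately show ?thesis using N by (simp add: diff_divide_distrib)
  qed
  then show ?thesis by blast
qed

theorem mainTheorem7:
  fixes \<beta> lam :: real
  assumes "lam < 1" and "0 < \<beta>" and "\<beta> < 1 - lam"
  shows "(\<lambda>N. quenchedPressure N \<beta> lam) \<longlonglongrightarrow> - (1/2) * ln (1 - lam)"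
proof -
  obtain c where c:
    "\<And>N. N > 0 \<Longrightarrow> quenchedPressure N \<beta> lam \<le> - (1/2) * ln (1 - lam)"
    "\<And>N. N > 0 \<Longrightarrow> - (1/2) * ln (1 - lam) - c / real N \<le> quenchedPressure N \<beta> lam"
    using quenchedPressure_bounds[OF assms] by blast
  have "(\<lambda>N. - (1/2) * ln (1 - lam) - c / real N) \<longlonglongrightarrow> - (1/2) * ln (1 - lam) - 0"
    by (intro tendsto_diff tendsto_const lim_const_over_n)
  then have "(\<lambda>N. - (1/2) * ln (1 - lam) - c / real N) \<longlonglongrightarrow> - (1/2) * ln (1 - lam)" by simp
  then show ?thesis
  proof (rule tendsto_sandwich[rotated 2, OF _ tendsto_const])
    show "\<forall>\<^sub>F N in sequentially. - (1/2) * ln (1 - lam) - c / real N \<le> quenchedPressure N \<beta> lam"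
      using eventually_gt_at_top[of 0] by eventually_elim (rule c(2))
    show "\<forall>\<^sub>F N in sequentially. quenchedPressure N \<beta> lam \<le> - (1/2) * ln (1 - lam)"
      using eventually_gt_at_top[of 0] by eventually_elim (rule c(1))
  qed
qed

end
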